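(* Let $d_n$ ($n\ge3$) be the number of staircase diagrams on the Dynkin graph $D_n$, $\overline d_n$ the number of fully supported ones, and $a_n$ the number of staircase diagrams on the path graph with $n$ vertices ($a_0=1$). With $D(t)=\sum_{n\ge3}d_nt^n$, $\overline D(t)=\sum_{n\ge3}\overline d_nt^n$, $A(t)=\sum_{n\ge0}a_nt^n$, $$D(t)=-2t-3t^2+(2t-t^2+t^3)A(t)+(tA(t)+1)\overline D(t).$$
   Context: The graph $D_n$ ($n\ge3$) has vertices $s_1,\dots,s_n$, with edges $s_i\sim s_{i+1}$ for $2\le i\le n-1$ and $s_1\sim s_3$. A staircase diagram on a graph with vertex set $S$ is a poset $(\mathcal D,\preceq)$ of nonempty subsets (blocks) of $S$ (empty diagram allowed) with: (1) each block connected, and if $B$ covers $B'$ then $B\cup B'$ connected; (2) $\mathcal D_s=\{B:s\in B\}$ a chain; (3) if $s\sim t$, $\mathcal D_s\cup\mathcal D_t$ a chain in which $\mathcal D_s,\mathcal D_t$ are saturated subchains; (4) each $B$ is the minimum of some $\mathcal D_s$ and maximum of some $\mathcal D_{s'}$. Fully supported: $\bigcup_B B=S$. *)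

theory Defs
  imports
    "Graph_Theory.Pair_Digraph"
    "Graph_Theory.Digraph_Component"
    "HOL-Computational_Algebra.Formal_Power_Series"
begin

section \<open>Graphs\<close>

text \<open>A finite simple graph is a \<open>pair_graph\<close>: an edge is represented by its two opposite arcs.\<close>

definition path_graph :: "nat \<Rightarrow> nat pair_pre_digraph" where
  "path_graph n = \<lparr> pverts = {1..n}, parcs = (\<Union>i\<in>{1..<n}. {(i, i + 1), (i + 1, i)}) \<rparr>"

text \<open>Only meaningful for \<open>n \<ge> 3\<close>.\<close>

definition D_graph :: "nat \<Rightarrow> nat pair_pre_digraph" where
  "D_graph n = \<lparr> pverts = {1..n},
     parcs = (\<Union>i\<in>{2..<n}. {(i, i + 1), (i + 1, i)}) \<union> {(1, 3), (3, 1)} \<rparr>"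

lemma pair_graph_path_graph: "pair_graph (path_graph n)"
proof unfold_locales
  have "sym (parcs (path_graph n))"
    by (rule symI) (auto simp: path_graph_def)
  then show "Digraph.symmetric (with_proj (path_graph n))"
    by (simp add: symmetric_def arcs_ends_def arc_to_ends_def)
qed (auto simp: path_graph_def)

lemma pair_graph_D_graph:
  assumes "n \<ge> 3"
  shows "pair_graph (D_graph n)"
proof unfold_locales
  have "sym (parcs (D_graph n))"
    by (rule symI) (auto simp: D_graph_def)
  then show "Digraph.symmetric (with_proj (D_graph n))"
    by (simp add: symmetric_def arcs_ends_def arc_to_ends_def)
qed (use assms in \<open>auto simp: D_graph_def\<close>)

text \<open>The name is qualified because topological connectedness is also called \<open>connected\<close>.\<close>

definition connected_in :: "'a pair_pre_digraph \<Rightarrow> 'a set \<Rightarrow> bool" where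
  "connected_in G B \<longleftrightarrow> Digraph_Component.connected (with_proj G \<restriction> B)"

section \<open>Posets\<close>

text \<open>A poset is a carrier set with a relation \<open>r\<close> such that \<open>partial_order_on P r\<close>;
  \<open>(x, y) \<in> r\<close> means \<open>x \<preceq> y\<close>. In \<open>covers P r y x\<close> the larger element \<open>y\<close> comes first.\<close>

definition covers :: "'b set \<Rightarrow> 'b rel \<Rightarrow> 'b \<Rightarrow> 'b \<Rightarrow> bool" where
  "covers P r y x \<longleftrightarrow> x \<in> P \<and> y \<in> P \<and> x \<noteq> y \<and> (x, y) \<in> r \<and>
     \<not> (\<exists>z\<in>P. z \<noteq> x \<and> z \<noteq> y \<and> (x, z) \<in> r \<and> (z, y) \<in> r)"

text \<open>\<open>C\<close> is a saturated subchain of \<open>P\<close> if no element of \<open>P\<close> outside \<open>C\<close>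
  lying between two elements of \<open>C\<close> can be added without losing the chain property.\<close>

definition saturated_subchain :: "'b set \<Rightarrow> 'b rel \<Rightarrow> 'b set \<Rightarrow> bool" where
  "saturated_subchain P r C \<longleftrightarrow> C \<subseteq> P \<and> C \<in> Chains r \<and>
     \<not> (\<exists>z\<in>P - C. \<exists>x\<in>C. \<exists>y\<in>C. (x, z) \<in> r \<and> (z, y) \<in> r \<and> insert z C \<in> Chains r)"

definition is_minimum :: "'b rel \<Rightarrow> 'b set \<Rightarrow> 'b \<Rightarrow> bool" where
  "is_minimum r C x \<longleftrightarrow> x \<in> C \<and> (\<forall>y\<in>C. (x, y) \<in> r)"

definition is_maximum :: "'b rel \<Rightarrow> 'b set \<Rightarrow> 'b \<Rightarrow> bool" where
  "is_maximum r C x \<longleftrightarrow> x \<in> C \<and> (\<forall>y\<in>C. (y, x) \<in> r)"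

section \<open>Staircase diagrams\<close>

definition blocks_at :: "'a set set \<Rightarrow> 'a \<Rightarrow> 'a set set" where
  "blocks_at \<D> s = {B \<in> \<D>. s \<in> B}"

definition staircase_diagram :: "'a pair_pre_digraph \<Rightarrow> 'a set set \<Rightarrow> 'a set rel \<Rightarrow> bool" where
  "staircase_diagram G \<D> r \<longleftrightarrow>
     (\<forall>B\<in>\<D>. B \<noteq> {} \<and> B \<subseteq> pverts G) \<and>
     partial_order_on \<D> r \<and>
     (\<forall>B\<in>\<D>. connected_in G B) \<and>
     (\<forall>B B'. covers \<D> r B B' \<longrightarrow> connected_in G (B \<union> B')) \<and>
     (\<forall>s\<in>pverts G. blocks_at \<D> s \<in> Chains r) \<and>
     (\<forall>(s, t)\<in>parcs G.
        blocks_at \<D> s \<union> blocks_at \<D> t \<in> Chains r \<and>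
        saturated_subchain (blocks_at \<D> s \<union> blocks_at \<D> t) r (blocks_at \<D> s) \<and>
        saturated_subchain (blocks_at \<D> s \<union> blocks_at \<D> t) r (blocks_at \<D> t)) \<and>
     (\<forall>B\<in>\<D>. (\<exists>s\<in>pverts G. is_minimum r (blocks_at \<D> s) B) \<and>
             (\<exists>s'\<in>pverts G. is_maximum r (blocks_at \<D> s') B))"

definition fully_supported :: "'a pair_pre_digraph \<Rightarrow> 'a set set \<Rightarrow> bool" where
  "fully_supported G \<D> \<longleftrightarrow> \<Union>\<D> = pverts G"

definition staircase_diagrams :: "'a pair_pre_digraph \<Rightarrow> ('a set set \<times> 'a set rel) set" where
  "staircase_diagrams G = {(\<D>, r). staircase_diagram G \<D> r}"

definition full_staircase_diagrams :: "'a pair_pre_digraph \<Rightarrow> ('a set set \<times> 'a set rel) set" where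
  "full_staircase_diagrams G = {(\<D>, r). staircase_diagram G \<D> r \<and> fully_supported G \<D>}"

text \<open>Finiteness ensures that taking \<open>card\<close> below really counts.\<close>

lemma finite_staircase_diagrams:
  assumes "finite (pverts G)"
  shows "finite (staircase_diagrams G)"
proof (rule finite_subset)
  show "staircase_diagrams G \<subseteq> Pow (Pow (pverts G)) \<times> Pow (Pow (pverts G) \<times> Pow (pverts G))"
  proof clarify
    fix \<D> r
    assume "(\<D>, r) \<in> staircase_diagrams G"
    then have "\<D> \<subseteq> Pow (pverts G)" "r \<subseteq> \<D> \<times> \<D>"
      by (simp_all add: staircase_diagrams_def staircase_diagram_def partial_order_on_def
          preorder_on_def subset_iff)
    then show "\<D> \<in> Pow (Pow (pverts G)) \<and> r \<in> Pow (Pow (pverts G) \<times> Pow (pverts G))"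
      by blast
  qed
qed (use assms in simp)

lemma finite_full_staircase_diagrams:
  assumes "finite (pverts G)"
  shows "finite (full_staircase_diagrams G)"
  by (rule finite_subset[OF _ finite_staircase_diagrams[OF assms]])
    (auto simp: full_staircase_diagrams_def staircase_diagrams_def)

definition path_count :: "nat \<Rightarrow> nat" where
  "path_count n = card (staircase_diagrams (path_graph n))"

definition D_count :: "nat \<Rightarrow> nat" where
  "D_count n = card (staircase_diagrams (D_graph n))"

definition D_full_count :: "nat \<Rightarrow> nat" where
  "D_full_count n = card (full_staircase_diagrams (D_graph n))"

text \<open>The empty graph has exactly the empty diagram, so no convention is needed at \<open>n = 0\<close>.\<close>

lemma path_count_0: "path_count 0 = 1"
proof -
  have "staircase_diagram (path_graph 0) \<D> r \<longleftrightarrow> \<D> = {} \<and> r = {}" for \<D> r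
  proof
    assume "staircase_diagram (path_graph 0) \<D> r"
    then have B: "\<forall>B\<in>\<D>. B \<noteq> {} \<and> B \<subseteq> pverts (path_graph 0)" and "r \<subseteq> \<D> \<times> \<D>"
      by (simp_all add: staircase_diagram_def partial_order_on_def preorder_on_def)
    moreover from B have "\<D> = {}"
      by (auto simp: path_graph_def)
    ultimately show "\<D> = {} \<and> r = {}"
      by simp
  next
    assume "\<D> = {} \<and> r = {}"
    then show "staircase_diagram (path_graph 0) \<D> r"
      by (simp add: staircase_diagram_def path_graph_def covers_def)
  qed
  then have "staircase_diagrams (path_graph 0) = {({}, {})}"
    by (auto simp: staircase_diagrams_def)
  then show ?thesis
    by (simp add: path_count_def)
qed

definition path_series :: "int fps" where
  "path_series = Abs_fps (\<lambda>n. int (path_count n))"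

definition D_series :: "int fps" where
  "D_series = Abs_fps (\<lambda>n. if n \<ge> 3 then int (D_count n) else 0)"

definition D_full_series :: "int fps" where
  "D_full_series = Abs_fps (\<lambda>n. if n \<ge> 3 then int (D_full_count n) else 0)"

end

theory Submission
  imports Defs
begin

text \<open>A diagram whose blocks avoid a vertex set \<open>X\<close> is the same thing as a diagram on the
  induced graph without \<open>X\<close>, and blocks lying in different components are incomparable, since the
  union of a block with one it covers is connected. Hence diagram counts are multiplicative over
  components. Sort the diagrams on \<open>D\<^sub>n\<close> by the first unsupported vertex \<open>i + 1 > 3\<close>: the fully
  supported ones on \<open>{1..i} \<simeq> D\<^sub>i\<close> combine freely with the diagrams on a path with \<open>n - 1 - i\<close>
  vertices. Those missing one of \<open>1, 2, 3\<close> are counted by inclusion and exclusion, which gives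
  \<open>2a\<^sub>n\<^sub>-\<^sub>1 - a\<^sub>n\<^sub>-\<^sub>2 + a\<^sub>n\<^sub>-\<^sub>3\<close>.\<close>

section \<open>Connected vertex sets\<close>

text \<open>The axioms speak of covering pairs, whereas splitting a diagram over components requires
  control of every comparable pair; finite intervals bridge the gap. The order is part of the data,
  so every map between sets of diagrams moves a family of blocks together with its relation, and
  much of the work shows that an axiom about a few blocks is insensitive to what the relation does
  elsewhere. The empty set is never a block, which keeps families on disjoint vertex sets disjoint.
  Vertices 1, 2, 3 are set apart because \<open>{1..i}\<close> induces \<open>D_graph i\<close> only
  from \<open>i = 3\<close> on. The resulting recurrence concerns \<open>n \<ge> 3\<close>; the
  polynomial \<open>- 2 * fps_X - 3 * fps_X ^ 2\<close> cancels what the factor times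
  \<open>path_series\<close> contributes in degrees 1 and 2.\<close>

lemma connected_in_iff:
  "connected_in G B \<longleftrightarrow> B \<noteq> {} \<and>
     (\<forall>u\<in>B. \<forall>v\<in>B. (u, v) \<in> {(x, y). x \<in> B \<and> y \<in> B \<and> ((x, y) \<in> parcs G \<or> (y, x) \<in> parcs G)}\<^sup>*)"
proof -
  let ?H = "with_proj G \<restriction> B"
  have symcl: "symcl (arcs_ends ?H) = {(x, y). x \<in> B \<and> y \<in> B \<and> ((x, y) \<in> parcs G \<or> (y, x) \<in> parcs G)}"
    by (force simp: symcl_def arcs_ends_def arc_to_ends_def induce_subgraph_def)
  \<comment> \<open>Once \<open>R\<close> lives inside \<open>B\<close>, a walk starting in
    \<open>B\<close> cannot leave it, so the carrier-restricted closure of the graph library agrees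
    with the ordinary one.\<close>
  have rtrancl: "(u, v) \<in> rtrancl_on B R \<longleftrightarrow> (u, v) \<in> R\<^sup>*"
    if "u \<in> B" and R: "R \<subseteq> B \<times> B" for u v and R :: "'a rel"
  proof
    show "(u, v) \<in> R\<^sup>*" if "(u, v) \<in> rtrancl_on B R"
      using that by induction auto
    show "(u, v) \<in> rtrancl_on B R" if "(u, v) \<in> R\<^sup>*"
      using that
    proof induction
      case base
      show ?case using \<open>u \<in> B\<close> by simp
    next
      case (step y z)
      then show ?case using R by (meson SigmaD2 rtrancl_on_into_rtrancl_on subsetD)
    qed
  qed
  show ?thesis
    unfolding connected_in_def connected_conv induce_subgraph_verts symcl
    by (intro conj_cong ball_cong refl rtrancl) auto
qed

lemma connected_in_cong:
  assumes "\<And>x y. x \<in> B \<Longrightarrow> y \<in> B \<Longrightarrow> (x, y) \<in> parcs G \<longleftrightarrow> (x, y) \<in> parcs H"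
  shows "connected_in G B \<longleftrightarrow> connected_in H B"
proof -
  have "{(x, y). x \<in> B \<and> y \<in> B \<and> ((x, y) \<in> parcs G \<or> (y, x) \<in> parcs G)} =
      {(x, y). x \<in> B \<and> y \<in> B \<and> ((x, y) \<in> parcs H \<or> (y, x) \<in> parcs H)}"
    using assms by auto
  then show ?thesis
    unfolding connected_in_iff by simp
qed

lemma connected_in_image:
  assumes "connected_in G B"
    and arcs: "\<And>x y. x \<in> B \<Longrightarrow> y \<in> B \<Longrightarrow> (x, y) \<in> parcs G \<Longrightarrow> (f x, f y) \<in> parcs H"
  shows "connected_in H (f ` B)"
  unfolding connected_in_iff
proof (intro conjI ballI)
  show "f ` B \<noteq> {}"
    using assms(1) by (simp add: connected_in_iff)
  let ?R = "{(x, y). x \<in> B \<and> y \<in> B \<and> ((x, y) \<in> parcs G \<or> (y, x) \<in> parcs G)}"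
  let ?S = "{(x, y). x \<in> f ` B \<and> y \<in> f ` B \<and> ((x, y) \<in> parcs H \<or> (y, x) \<in> parcs H)}"
  fix u' v'
  assume "u' \<in> f ` B" "v' \<in> f ` B"
  then obtain u v where uv: "u \<in> B" "v \<in> B" and eq: "u' = f u" "v' = f v"
    by auto
  from uv assms(1) have "(u, v) \<in> ?R\<^sup>*"
    unfolding connected_in_iff by blast
  then have "(f u, f v) \<in> ?S\<^sup>*"
  proof induction
    case (step y z)
    then have "(f y, f z) \<in> ?S"
      using arcs by blast
    with step.IH show ?case
      by (rule rtrancl_into_rtrancl)
  qed simp
  then show "(u', v') \<in> ?S\<^sup>*"
    unfolding eq .
qed

text \<open>A walk inside \<open>B\<close> that starts at \<open>b\<close> in \<open>X\<close> never
  finds an edge leading out of \<open>X\<close>. This is the form in which connectedness separates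
  components.\<close>

lemma connected_in_subset:
  assumes "connected_in G B" and "b \<in> B" "b \<in> X"
    and cut: "\<And>x y. x \<in> B \<inter> X \<Longrightarrow> y \<in> B - X \<Longrightarrow> (x, y) \<notin> parcs G \<and> (y, x) \<notin> parcs G"
  shows "B \<subseteq> X"
proof
  fix v
  assume "v \<in> B"
  then have "(b, v) \<in> {(x, y). x \<in> B \<and> y \<in> B \<and> ((x, y) \<in> parcs G \<or> (y, x) \<in> parcs G)}\<^sup>*"
    using assms(1,2) unfolding connected_in_iff by blast
  then show "v \<in> X"
    by induction (use \<open>b \<in> X\<close> cut in auto)
qed

section \<open>Induced subgraphs\<close>

text \<open>The result is again a \<open>pair_pre_digraph\<close>, the type over which diagrams are
  defined, unlike a restriction of \<open>with_proj G\<close>. The vertex set is \<open>W\<close>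
  itself, not its intersection with \<open>pverts G\<close>.\<close>

definition induced :: "'a pair_pre_digraph \<Rightarrow> 'a set \<Rightarrow> 'a pair_pre_digraph" where
  "induced G W = \<lparr> pverts = W, parcs = {(x, y) \<in> parcs G. x \<in> W \<and> y \<in> W} \<rparr>"

lemma pverts_induced [simp]: "pverts (induced G W) = W"
  by (simp add: induced_def)

lemma in_parcs_induced [simp]: "(x, y) \<in> parcs (induced G W) \<longleftrightarrow> (x, y) \<in> parcs G \<and> x \<in> W \<and> y \<in> W"
  by (simp add: induced_def)

lemma connected_in_induced: "B \<subseteq> W \<Longrightarrow> connected_in (induced G W) B \<longleftrightarrow> connected_in G B"
  by (rule connected_in_cong) auto

section \<open>The diagram axioms clause by clause, and restriction of the vertex set\<close>

lemma staircase_diagramI: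
  assumes "\<And>B. B \<in> D \<Longrightarrow> B \<noteq> {}" "\<And>B. B \<in> D \<Longrightarrow> B \<subseteq> pverts G"
    and "partial_order_on D r"
    and "\<And>B. B \<in> D \<Longrightarrow> connected_in G B"
    and "\<And>B B'. covers D r B B' \<Longrightarrow> connected_in G (B \<union> B')"
    and "\<And>s. s \<in> pverts G \<Longrightarrow> blocks_at D s \<in> Chains r"
    and "\<And>s t. (s, t) \<in> parcs G \<Longrightarrow> blocks_at D s \<union> blocks_at D t \<in> Chains r"
    and "\<And>s t. (s, t) \<in> parcs G \<Longrightarrow> saturated_subchain (blocks_at D s \<union> blocks_at D t) r (blocks_at D s)"
    and "\<And>s t. (s, t) \<in> parcs G \<Longrightarrow> saturated_subchain (blocks_at D s \<union> blocks_at D t) r (blocks_at D t)"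
    and "\<And>B. B \<in> D \<Longrightarrow> \<exists>s\<in>pverts G. is_minimum r (blocks_at D s) B"
    and "\<And>B. B \<in> D \<Longrightarrow> \<exists>s\<in>pverts G. is_maximum r (blocks_at D s) B"
  shows "staircase_diagram G D r"
  unfolding staircase_diagram_def
  by (intro conjI ballI allI impI; (clarify, intro conjI)?; (rule assms | erule assms))

text \<open>Later proofs cite these facts by position: 1-2 place the blocks, 3 is the order, 4-5 are
  connectivity, 6 is the chain at a vertex, 7-9 are the edge conditions, 10-11 the extremal
  vertices.\<close>

lemma staircase_diagramD:
  assumes "staircase_diagram G D r"
  shows "\<And>B. B \<in> D \<Longrightarrow> B \<noteq> {}" "\<And>B. B \<in> D \<Longrightarrow> B \<subseteq> pverts G"
    and "partial_order_on D r"
    and "\<And>B. B \<in> D \<Longrightarrow> connected_in G B"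
    and "\<And>B B'. covers D r B B' \<Longrightarrow> connected_in G (B \<union> B')"
    and "\<And>s. s \<in> pverts G \<Longrightarrow> blocks_at D s \<in> Chains r"
    and "\<And>s t. (s, t) \<in> parcs G \<Longrightarrow> blocks_at D s \<union> blocks_at D t \<in> Chains r"
    and "\<And>s t. (s, t) \<in> parcs G \<Longrightarrow> saturated_subchain (blocks_at D s \<union> blocks_at D t) r (blocks_at D s)"
    and "\<And>s t. (s, t) \<in> parcs G \<Longrightarrow> saturated_subchain (blocks_at D s \<union> blocks_at D t) r (blocks_at D t)"
    and "\<And>B. B \<in> D \<Longrightarrow> \<exists>s\<in>pverts G. is_minimum r (blocks_at D s) B"
    and "\<And>B. B \<in> D \<Longrightarrow> \<exists>s\<in>pverts G. is_maximum r (blocks_at D s) B"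
proof -
  note conds = assms[unfolded staircase_diagram_def]
  show "\<And>B. B \<in> D \<Longrightarrow> B \<noteq> {}" "\<And>B. B \<in> D \<Longrightarrow> B \<subseteq> pverts G"
    using conjunct1[OF conds] by blast+
  show "partial_order_on D r"
    using conds by (elim conjE)
  show "\<And>B. B \<in> D \<Longrightarrow> connected_in G B"
    using conds by (elim conjE) (drule (2) bspec)
  show "\<And>B B'. covers D r B B' \<Longrightarrow> connected_in G (B \<union> B')"
    using conds by (elim conjE) blast
  show "\<And>s. s \<in> pverts G \<Longrightarrow> blocks_at D s \<in> Chains r"
    using conds by (elim conjE) (drule (2) bspec)
  show "blocks_at D s \<union> blocks_at D t \<in> Chains r"
    "saturated_subchain (blocks_at D s \<union> blocks_at D t) r (blocks_at D s)"
    "saturated_subchain (blocks_at D s \<union> blocks_at D t) r (blocks_at D t)"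
    if "(s, t) \<in> parcs G" for s t
    using conds by (elim conjE, drule_tac bspec[OF _ that], simp)+
  have "\<forall>B\<in>D. (\<exists>s\<in>pverts G. is_minimum r (blocks_at D s) B) \<and> (\<exists>s\<in>pverts G. is_maximum r (blocks_at D s) B)"
    using conds by (elim conjE)
  note extr = bspec[OF this]
  show "\<exists>s\<in>pverts G. is_minimum r (blocks_at D s) B" if "B \<in> D" for B
    by (rule conjunct1[OF extr[OF that]])
  show "\<exists>s\<in>pverts G. is_maximum r (blocks_at D s) B" if "B \<in> D" for B
    by (rule conjunct2[OF extr[OF that]])
qed

lemma blocks_at_eq_empty: "s \<notin> \<Union>D \<Longrightarrow> blocks_at D s = {}"
  by (auto simp: blocks_at_def)

lemma covers_in: "covers D r B B' \<Longrightarrow> B \<in> D \<and> B' \<in> D"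
  by (simp add: covers_def)

lemma Chains_empty [simp]: "{} \<in> Chains r"
  by (simp add: Chains_def)

lemma saturated_subchain_empty [simp]: "saturated_subchain P r {}"
  by (simp add: saturated_subchain_def)

lemma saturated_subchain_self [simp]: "saturated_subchain C r C \<longleftrightarrow> C \<in> Chains r"
  by (simp add: saturated_subchain_def)

text \<open>The pair \<open>D\<close>, \<open>r\<close> is the same on both sides, so covers are
  unchanged. Only vertices and edges are gained or lost, and a vertex outside the support carries no
  blocks, hence imposes nothing.\<close>

lemma staircase_diagram_induced_iff:
  assumes W: "W \<subseteq> pverts G"
  shows "staircase_diagram (induced G W) D r \<longleftrightarrow> staircase_diagram G D r \<and> \<Union>D \<subseteq> W"
proof (intro iffI conjI; (elim conjE)?)
  assume sd: "staircase_diagram (induced G W) D r"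
  note d = staircase_diagramD[OF sd, unfolded pverts_induced in_parcs_induced]
  show sub: "\<Union>D \<subseteq> W"
    using d(2) by auto
  have Chain: "blocks_at D s \<in> Chains r" for s
  proof (cases "s \<in> W")
    case False
    then have "s \<notin> \<Union>D" using sub by blast
    then show ?thesis
      by (simp add: blocks_at_eq_empty)
  qed (rule d(6))
  have edge: "blocks_at D s \<union> blocks_at D t \<in> Chains r"
      "saturated_subchain (blocks_at D s \<union> blocks_at D t) r (blocks_at D s)"
      "saturated_subchain (blocks_at D s \<union> blocks_at D t) r (blocks_at D t)"
    if st: "(s, t) \<in> parcs G" for s t
  proof -
    \<comment> \<open>An edge not inside \<open>W\<close> has an endpoint with no blocks; the union
      then collapses to the chain at the other endpoint, and both saturation claims become
      trivial.\<close>
    consider "s \<in> W \<and> t \<in> W" | "s \<notin> \<Union>D" | "t \<notin> \<Union>D"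
      using sub by blast
    then have *: "blocks_at D s \<union> blocks_at D t \<in> Chains r \<and>
      saturated_subchain (blocks_at D s \<union> blocks_at D t) r (blocks_at D s) \<and>
      saturated_subchain (blocks_at D s \<union> blocks_at D t) r (blocks_at D t)"
      by cases (simp_all add: st d(7-9) blocks_at_eq_empty Chain)
    show "blocks_at D s \<union> blocks_at D t \<in> Chains r"
      by (rule conjunct1[OF *])
    show "saturated_subchain (blocks_at D s \<union> blocks_at D t) r (blocks_at D s)"
      by (rule conjunct1[OF conjunct2[OF *]])
    show "saturated_subchain (blocks_at D s \<union> blocks_at D t) r (blocks_at D t)"
      by (rule conjunct2[OF conjunct2[OF *]])
  qed
  show "staircase_diagram G D r"
  proof (rule staircase_diagramI)
    show "B \<subseteq> pverts G" if "B \<in> D" for B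
      using d(2)[OF that] W by (rule subset_trans)
    show "connected_in G B" if "B \<in> D" for B
      using d(4)[OF that] d(2)[OF that] by (simp add: connected_in_induced)
    show "connected_in G (B \<union> B')" if "covers D r B B'" for B B'
      using d(5)[OF that] d(2) covers_in[OF that] by (simp add: connected_in_induced)
    show "\<exists>s\<in>pverts G. is_minimum r (blocks_at D s) B" if "B \<in> D" for B
      using d(10)[OF that] W by blast
    show "\<exists>s\<in>pverts G. is_maximum r (blocks_at D s) B" if "B \<in> D" for B
      using d(11)[OF that] W by blast
  qed (use d(1,3) Chain edge in blast)+
next
  assume sd: "staircase_diagram G D r" and sub: "\<Union>D \<subseteq> W"
  note d = staircase_diagramD[OF sd]
  show "staircase_diagram (induced G W) D r"
  proof (rule staircase_diagramI; (unfold pverts_induced in_parcs_induced)?)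
    show "B \<subseteq> W" if "B \<in> D" for B
      using sub that by blast
    show "connected_in (induced G W) B" if "B \<in> D" for B
      using d(4)[OF that] sub that by (subst connected_in_induced) auto
    show "connected_in (induced G W) (B \<union> B')" if "covers D r B B'" for B B'
      using d(5)[OF that] sub covers_in[OF that] by (subst connected_in_induced) auto
    show "blocks_at D s \<in> Chains r" if "s \<in> W" for s
      using d(6) that W by blast
    show "\<exists>s\<in>W. is_minimum r (blocks_at D s) B" if B: "B \<in> D" for B
    proof -
      obtain s where "is_minimum r (blocks_at D s) B" using d(10)[OF B] by (elim bexE)
      \<comment> \<open>A minimum of \<open>blocks_at D s\<close> is a member of it, so the witness
        \<open>s\<close> lies in \<open>B\<close> and therefore in the support.\<close>
      moreover from this have "s \<in> W"
        using sub B by (auto simp: is_minimum_def blocks_at_def)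
      ultimately show ?thesis by (rule bexI)
    qed
    show "\<exists>s\<in>W. is_maximum r (blocks_at D s) B" if B: "B \<in> D" for B
    proof -
      obtain s where "is_maximum r (blocks_at D s) B" using d(11)[OF B] by (elim bexE)
      moreover from this have "s \<in> W"
        using sub B by (auto simp: is_maximum_def blocks_at_def)
      ultimately show ?thesis by (rule bexI)
    qed
  qed (use d(1,3,7-9) in blast)+
qed


text \<open>With the ambient graph fixed, deleting vertices and splitting into components become
  operations on the set \<open>W\<close> alone.\<close>

definition diagram_count :: "'a pair_pre_digraph \<Rightarrow> 'a set \<Rightarrow> nat" where
  "diagram_count G W = card (staircase_diagrams (induced G W))"

lemma unsupported_eq_induced:
  "{(D, r). staircase_diagram G D r \<and> \<Union>D \<inter> X = {}} = staircase_diagrams (induced G (pverts G - X))"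
proof -
  have "staircase_diagram G D r \<and> \<Union>D \<inter> X = {} \<longleftrightarrow> staircase_diagram (induced G (pverts G - X)) D r" for D r
  proof -
    have "\<Union>D \<subseteq> pverts G" if "staircase_diagram G D r"
      using staircase_diagramD(2)[OF that] by (rule Union_least)
    then show ?thesis
      unfolding staircase_diagram_induced_iff[OF Diff_subset] by blast
  qed
  then show ?thesis
    by (simp add: staircase_diagrams_def)
qed

section \<open>Graph isomorphisms\<close>

lemma Chains_image_iff:
  assumes "\<And>a b. a \<in> C \<Longrightarrow> b \<in> C \<Longrightarrow> (F a, F b) \<in> r' \<longleftrightarrow> (a, b) \<in> r"
  shows "F ` C \<in> Chains r' \<longleftrightarrow> C \<in> Chains r"
  using assms by (auto simp: Chains_def)

text \<open>A violation of saturation in the image pulls back: a preimage in \<open>P\<close> of an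
  element outside the image of \<open>C\<close> lies outside \<open>C\<close>, and
  \<open>agree\<close> returns both the comparabilities and the chain property.\<close>

lemma saturated_subchain_image:
  assumes "saturated_subchain P r C"
    and agree: "\<And>a b. a \<in> P \<Longrightarrow> b \<in> P \<Longrightarrow> (F a, F b) \<in> r' \<longleftrightarrow> (a, b) \<in> r"
  shows "saturated_subchain (F ` P) r' (F ` C)"
proof -
  have sub: "C \<subseteq> P" and chain: "C \<in> Chains r"
    and sat: "\<And>z x y. z \<in> P \<Longrightarrow> z \<notin> C \<Longrightarrow> x \<in> C \<Longrightarrow> y \<in> C \<Longrightarrow> (x, z) \<in> r \<Longrightarrow> (z, y) \<in> r \<Longrightarrow>
      insert z C \<notin> Chains r"
    using assms(1) unfolding saturated_subchain_def by blast+
  have ch: "F ` K \<in> Chains r' \<longleftrightarrow> K \<in> Chains r" if "K \<subseteq> P" for K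
    by (rule Chains_image_iff) (use that agree in blast)
  have "insert z' (F ` C) \<notin> Chains r'"
    if "z' \<in> F ` P - F ` C" "x' \<in> F ` C" "y' \<in> F ` C" "(x', z') \<in> r'" "(z', y') \<in> r'" for z' x' y'
  proof -
    from that(1-3) obtain z x y where z: "z' = F z" "z \<in> P" "z \<notin> C"
      and x: "x' = F x" "x \<in> C" and y: "y' = F y" "y \<in> C"
      by blast
    then have "(x, z) \<in> r" "(z, y) \<in> r"
      using that(4,5) agree sub by blast+
    then have "insert z C \<notin> Chains r"
      using sat z x y by blast
    moreover have "insert z C \<subseteq> P"
      using z(2) sub by blast
    ultimately show ?thesis
      using ch[of "insert z C"] z(1) by simp
  qed
  moreover have "F ` C \<subseteq> F ` P" "F ` C \<in> Chains r'"
    using sub chain ch by blast+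
  ultimately show ?thesis
    unfolding saturated_subchain_def by blast
qed

lemma is_minimum_image:
  assumes "is_minimum r C x"
    and "\<And>a b. a \<in> C \<Longrightarrow> b \<in> C \<Longrightarrow> (F a, F b) \<in> r' \<longleftrightarrow> (a, b) \<in> r"
  shows "is_minimum r' (F ` C) (F x)"
  using assms by (auto simp: is_minimum_def)

lemma is_maximum_image:
  assumes "is_maximum r C x"
    and "\<And>a b. a \<in> C \<Longrightarrow> b \<in> C \<Longrightarrow> (F a, F b) \<in> r' \<longleftrightarrow> (a, b) \<in> r"
  shows "is_maximum r' (F ` C) (F x)"
  using assms by (auto simp: is_maximum_def)

text \<open>With the identity for \<open>F\<close>, these compare two relations on the same blocks.
  Restricting to a component and gluing two parts both alter the relation only away from the blocks
  in question.\<close>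

lemmas Chains_cong = Chains_image_iff[where F = "\<lambda>x. x", unfolded image_ident]
lemmas saturated_subchain_cong = saturated_subchain_image[where F = "\<lambda>x. x", unfolded image_ident]
lemmas is_minimum_cong = is_minimum_image[where F = "\<lambda>x. x", unfolded image_ident]
lemmas is_maximum_cong = is_maximum_image[where F = "\<lambda>x. x", unfolded image_ident]

section \<open>Transport of the order and of whole diagrams along a vertex bijection\<close>

lemma map_prod_image_iff:
  assumes "inj_on F D" "r \<subseteq> D \<times> D" "a \<in> D" "b \<in> D"
  shows "(F a, F b) \<in> map_prod F F ` r \<longleftrightarrow> (a, b) \<in> r"
proof
  assume "(F a, F b) \<in> map_prod F F ` r"
  then obtain a' b' where "(a', b') \<in> r" "F a = F a'" "F b = F b'"
    by auto
  moreover from this assms(2) have "a' \<in> D" "b' \<in> D"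
    by auto
  ultimately show "(a, b) \<in> r"
    using assms(1,3,4) by (metis inj_onD)
qed (rule map_prod_imageI)

lemma partial_order_on_image:
  assumes po: "partial_order_on D r" and inj: "inj_on F D"
  shows "partial_order_on (F ` D) (map_prod F F ` r)"
proof -
  have r: "r \<subseteq> D \<times> D" and "refl_on D r" "trans r" "antisym r"
    using po by (simp_all add: partial_order_on_def preorder_on_def)
  note agree = map_prod_image_iff[OF inj r]
  have r': "map_prod F F ` r \<subseteq> F ` D \<times> F ` D"
    using r by auto
  have "refl_on (F ` D) (map_prod F F ` r)"
    using \<open>refl_on D r\<close> by (auto simp: refl_on_def)
  moreover have "trans (map_prod F F ` r)"
  proof (rule transI)
    fix x y z
    assume *: "(x, y) \<in> map_prod F F ` r" "(y, z) \<in> map_prod F F ` r"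
    then have "x \<in> F ` D" "y \<in> F ` D" "z \<in> F ` D"
      using r' by auto
    then obtain a b c where "x = F a" "y = F b" "z = F c" "a \<in> D" "b \<in> D" "c \<in> D"
      by auto
    then show "(x, z) \<in> map_prod F F ` r"
      using * agree \<open>trans r\<close> by (metis transD)
  qed
  moreover have "antisym (map_prod F F ` r)"
  proof (rule antisymI)
    fix x y
    assume *: "(x, y) \<in> map_prod F F ` r" "(y, x) \<in> map_prod F F ` r"
    then have "x \<in> F ` D" "y \<in> F ` D"
      using r' by auto
    then obtain a b where "x = F a" "y = F b" "a \<in> D" "b \<in> D"
      by auto
    then show "x = y"
      using * agree \<open>antisym r\<close> by (metis antisymD)
  qed
  ultimately show ?thesis
    using r' by (simp add: partial_order_on_def preorder_on_def)
qed

text \<open>Covers are pulled back rather than pushed forward: connectivity of unions is known in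
  the source and has to be verified for each cover in the image.\<close>

lemma covers_image:
  assumes cov: "covers (F ` D) r' (F a) (F b)" and D: "a \<in> D" "b \<in> D" and inj: "inj_on F D"
    and agree: "\<And>a b. a \<in> D \<Longrightarrow> b \<in> D \<Longrightarrow> (F a, F b) \<in> r' \<longleftrightarrow> (a, b) \<in> r"
  shows "covers D r a b"
proof -
  have "(b, a) \<in> r" "b \<noteq> a"
    using cov D agree by (auto simp: covers_def)
  moreover have "z = b \<or> z = a" if "z \<in> D" "(b, z) \<in> r" "(z, a) \<in> r" for z
    using cov that D agree inj_on_eq_iff[OF inj] by (auto simp: covers_def)
  ultimately show ?thesis
    using D by (auto simp: covers_def)
qed

text \<open>The vertex map is lifted to blocks by \<open>image\<close> and to the order by
  \<open>map_prod\<close>. As \<open>wf\<close> confines the arcs of \<open>H\<close> to its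
  vertices, every arc condition of \<open>H\<close> comes from an arc of \<open>G\<close>.\<close>

lemma staircase_diagram_image:
  assumes sd: "staircase_diagram G D r"
    and inj: "inj_on f (pverts G)"
    and verts: "pverts H = f ` pverts G"
    and arcs: "\<And>x y. x \<in> pverts G \<Longrightarrow> y \<in> pverts G \<Longrightarrow> (f x, f y) \<in> parcs H \<longleftrightarrow> (x, y) \<in> parcs G"
    and wf: "parcs H \<subseteq> pverts H \<times> pverts H"
  shows "staircase_diagram H ((`) f ` D) (map_prod ((`) f) ((`) f) ` r)"
proof -
  note d = staircase_diagramD[OF sd]
  let ?F = "(`) f" and ?D = "(`) f ` D" and ?r = "map_prod ((`) f) ((`) f) ` r"
  have injF: "inj_on ?F (Pow (pverts G))"
    by (rule inj_on_image_Pow[OF inj])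
  have D: "D \<subseteq> Pow (pverts G)"
    using d(2) by blast
  have injD: "inj_on ?F D"
    by (rule inj_on_subset[OF injF D])
  have r: "r \<subseteq> D \<times> D"
    using d(3) by (simp add: partial_order_on_def preorder_on_def)
  note agree = map_prod_image_iff[OF injD r]
  \<comment> \<open>This identity reduces all vertex and edge axioms to the image lemmas;
    injectivity of \<open>f\<close> prevents \<open>f s\<close> from entering the image of a block
    that misses \<open>s\<close>.\<close>
  have blocks: "blocks_at ?D (f s) = ?F ` blocks_at D s" if "s \<in> pverts G" for s
  proof -
    have "f s \<in> f ` B \<longleftrightarrow> s \<in> B" if "B \<in> D" for B
      using inj d(2)[OF that] \<open>s \<in> pverts G\<close> by (auto dest: inj_onD)
    then show ?thesis
      by (auto simp: blocks_at_def)
  qed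
  have blocks_sub: "blocks_at D s \<subseteq> D" for s
    by (auto simp: blocks_at_def)
  have blocks_Un_sub: "blocks_at D s \<union> blocks_at D t \<subseteq> D" for s t
    using blocks_sub by simp
  have agree_sub: "(?F A, ?F B) \<in> ?r \<longleftrightarrow> (A, B) \<in> r" if "C \<subseteq> D" "A \<in> C" "B \<in> C" for A B C
    by (rule agree[OF subsetD[OF that(1,2)] subsetD[OF that(1,3)]])
  note cov = covers_image[OF _ _ _ injD agree]
  have conn: "connected_in H (f ` B)" if "connected_in G B" "B \<subseteq> pverts G" for B
    using that(1) by (rule connected_in_image) (use arcs that(2) in blast)
  have arcE: "\<exists>s t. s' = f s \<and> t' = f t \<and> s \<in> pverts G \<and> t \<in> pverts G \<and> (s, t) \<in> parcs G"
    if "(s', t') \<in> parcs H" for s' t'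
  proof -
    from that wf have "s' \<in> f ` pverts G" "t' \<in> f ` pverts G"
      unfolding verts by auto
    then obtain s t where "s' = f s" "t' = f t" "s \<in> pverts G" "t \<in> pverts G"
      by auto
    with that arcs show ?thesis by blast
  qed
  show ?thesis
  proof (rule staircase_diagramI)
    show "B \<noteq> {}" if "B \<in> ?D" for B
      using that d(1) by auto
    show "B \<subseteq> pverts H" if "B \<in> ?D" for B
      using that d(2) verts by auto
    show "partial_order_on ?D ?r"
      by (rule partial_order_on_image[OF d(3) injD])
    show "connected_in H B" if "B \<in> ?D" for B
      using that conn d(2,4) by auto
    show "connected_in H (B \<union> B')" if c: "covers ?D ?r B B'" for B B'
    proof -
      from c obtain A A' where A: "B = ?F A" "B' = ?F A'" "A \<in> D" "A' \<in> D"
        by (auto dest: covers_in)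
      then have "connected_in G (A \<union> A')"
        using c cov d(5) by blast
      then have "connected_in H (f ` (A \<union> A'))"
        using A d(2) by (intro conn) auto
      then show ?thesis
        using A by (simp add: image_Un)
    qed
    show "blocks_at ?D s' \<in> Chains ?r" if s': "s' \<in> pverts H" for s'
    proof -
      from s' obtain s where s: "s' = f s" "s \<in> pverts G"
        using verts by auto
      show ?thesis
        unfolding s(1) blocks[OF s(2)]
        by (rule Chains_image_iff[THEN iffD2, rotated], rule d(6)[OF s(2)], erule (1) agree_sub[OF blocks_sub])
    qed
    show "blocks_at ?D s' \<union> blocks_at ?D t' \<in> Chains ?r"
      if "(s', t') \<in> parcs H" for s' t'
    proof -
      from arcE[OF that] obtain s t where st: "s' = f s" "t' = f t" "s \<in> pverts G" "t \<in> pverts G" "(s, t) \<in> parcs G"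
        by blast
      show ?thesis
        unfolding st(1,2) blocks[OF st(3)] blocks[OF st(4)] image_Un[symmetric]
        by (rule Chains_image_iff[THEN iffD2, rotated], rule d(7)[OF st(5)], erule (1) agree_sub[OF blocks_Un_sub])
    qed
    show "saturated_subchain (blocks_at ?D s' \<union> blocks_at ?D t') ?r (blocks_at ?D s')"
      if "(s', t') \<in> parcs H" for s' t'
    proof -
      from arcE[OF that] obtain s t where st: "s' = f s" "t' = f t" "s \<in> pverts G" "t \<in> pverts G" "(s, t) \<in> parcs G"
        by blast
      show ?thesis
        unfolding st(1,2) blocks[OF st(3)] blocks[OF st(4)] image_Un[symmetric]
        by (rule saturated_subchain_image[OF d(8)[OF st(5)]], erule (1) agree_sub[OF blocks_Un_sub])
    qed
    show "saturated_subchain (blocks_at ?D s' \<union> blocks_at ?D t') ?r (blocks_at ?D t')"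
      if "(s', t') \<in> parcs H" for s' t'
    proof -
      from arcE[OF that] obtain s t where st: "s' = f s" "t' = f t" "s \<in> pverts G" "t \<in> pverts G" "(s, t) \<in> parcs G"
        by blast
      show ?thesis
        unfolding st(1,2) blocks[OF st(3)] blocks[OF st(4)] image_Un[symmetric]
        by (rule saturated_subchain_image[OF d(9)[OF st(5)]], erule (1) agree_sub[OF blocks_Un_sub])
    qed
    show "\<exists>s\<in>pverts H. is_minimum ?r (blocks_at ?D s) B" if "B \<in> ?D" for B
    proof -
      from that obtain A where A: "B = ?F A" "A \<in> D"
        by auto
      from d(10)[OF A(2)] obtain s where s: "s \<in> pverts G" "is_minimum r (blocks_at D s) A"
        by blast
      have "is_minimum ?r (blocks_at ?D (f s)) B"
        unfolding blocks[OF s(1)] A(1)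
        by (rule is_minimum_image[OF s(2)], erule (1) agree_sub[OF blocks_sub])
      then show ?thesis
        using s(1) verts by blast
    qed
    show "\<exists>s\<in>pverts H. is_maximum ?r (blocks_at ?D s) B" if "B \<in> ?D" for B
    proof -
      from that obtain A where A: "B = ?F A" "A \<in> D"
        by auto
      from d(11)[OF A(2)] obtain s where s: "s \<in> pverts G" "is_maximum r (blocks_at D s) A"
        by blast
      have "is_maximum ?r (blocks_at ?D (f s)) B"
        unfolding blocks[OF s(1)] A(1)
        by (rule is_maximum_image[OF s(2)], erule (1) agree_sub[OF blocks_sub])
      then show ?thesis
        using s(1) verts by blast
    qed
  qed
qed

lemma card_staircase_diagrams_le:
  assumes inj: "inj_on f (pverts G)"
    and verts: "pverts H = f ` pverts G"
    and arcs: "\<And>x y. x \<in> pverts G \<Longrightarrow> y \<in> pverts G \<Longrightarrow> (f x, f y) \<in> parcs H \<longleftrightarrow> (x, y) \<in> parcs G"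
    and wf: "parcs H \<subseteq> pverts H \<times> pverts H"
    and fin: "finite (pverts G)"
  shows "card (staircase_diagrams G) \<le> card (staircase_diagrams H)"
proof (rule card_inj_on_le)
  let ?F = "(`) f"
  let ?P = "Pow (pverts G)"
  let ?g = "map_prod ((`) ?F) ((`) (map_prod ?F ?F))"
  have F: "inj_on ?F ?P"
    by (rule inj_on_image_Pow[OF inj])
  have "inj_on ?g (Pow ?P \<times> Pow (?P \<times> ?P))"
    by (intro map_prod_inj_on inj_on_image_Pow F)
  moreover have "staircase_diagrams G \<subseteq> Pow ?P \<times> Pow (?P \<times> ?P)"
  proof clarify
    fix D r
    assume "(D, r) \<in> staircase_diagrams G"
    then have "staircase_diagram G D r"
      by (simp add: staircase_diagrams_def)
    note d = staircase_diagramD(2,3)[OF this]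
    from d(2) have "r \<subseteq> D \<times> D"
      by (simp add: partial_order_on_def preorder_on_def)
    with d(1) show "D \<in> Pow ?P \<and> r \<in> Pow (?P \<times> ?P)"
      by blast
  qed
  ultimately show "inj_on ?g (staircase_diagrams G)"
    by (rule inj_on_subset)
  show "?g ` staircase_diagrams G \<subseteq> staircase_diagrams H"
    using staircase_diagram_image[OF _ inj verts arcs wf]
    by (auto simp: staircase_diagrams_def)
  show "finite (staircase_diagrams H)"
    by (rule finite_staircase_diagrams) (simp add: verts fin)
qed

text \<open>Two injections between finite sets, one induced by \<open>f\<close> and one by
  \<open>inv_into\<close>, give equality without an explicit inverse at the level of
  diagrams.\<close>

lemma card_staircase_diagrams_iso:
  assumes inj: "inj_on f (pverts G)"
    and verts: "pverts H = f ` pverts G"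
    and arcs: "\<And>x y. x \<in> pverts G \<Longrightarrow> y \<in> pverts G \<Longrightarrow> (f x, f y) \<in> parcs H \<longleftrightarrow> (x, y) \<in> parcs G"
    and wf: "parcs G \<subseteq> pverts G \<times> pverts G" "parcs H \<subseteq> pverts H \<times> pverts H"
    and fin: "finite (pverts G)"
  shows "card (staircase_diagrams G) = card (staircase_diagrams H)"
proof (rule antisym)
  show "card (staircase_diagrams G) \<le> card (staircase_diagrams H)"
    by (rule card_staircase_diagrams_le[OF inj verts arcs wf(2) fin])
  let ?g = "inv_into (pverts G) f"
  show "card (staircase_diagrams H) \<le> card (staircase_diagrams G)"
  proof (rule card_staircase_diagrams_le[OF _ _ _ wf(1)])
    show "inj_on ?g (pverts H)"
      unfolding verts by (rule inj_on_inv_into) simp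
    show "pverts G = ?g ` pverts H"
      unfolding verts using inj by simp
    show "(?g x, ?g y) \<in> parcs G \<longleftrightarrow> (x, y) \<in> parcs H" if "x \<in> pverts H" "y \<in> pverts H" for x y
      using that arcs[of "?g x" "?g y"] unfolding verts by (simp add: f_inv_into_f inv_into_into)
    show "finite (pverts H)"
      by (simp add: verts fin)
  qed
qed


section \<open>Disjoint unions of graphs\<close>

lemma induced_induced [simp]: "W \<subseteq> U \<Longrightarrow> induced (induced G U) W = induced G W"
  by (auto simp: induced_def)

text \<open>By \<open>block\<close>, the blocks at a vertex of \<open>W\<close> are not affected by
  the restriction; by \<open>rel\<close>, neither are the intervals between surviving blocks, so a
  cover in the restricted order is already a cover in \<open>D\<close>.\<close>

lemma staircase_diagram_component:
  assumes sd: "staircase_diagram G D r" and W: "W \<subseteq> pverts G"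
    and block: "\<And>B. B \<in> D \<Longrightarrow> B \<subseteq> W \<or> B \<inter> W = {}"
    and rel: "\<And>A B. (A, B) \<in> r \<Longrightarrow> A \<subseteq> W \<longleftrightarrow> B \<subseteq> W"
  shows "staircase_diagram (induced G W) (D \<inter> Pow W) (r \<inter> (Pow W \<times> Pow W))"
    (is "staircase_diagram ?H ?D ?r")
proof -
  note d = staircase_diagramD[OF sd]
  have r: "r \<subseteq> D \<times> D" and po: "refl_on D r" "trans r" "antisym r"
    using d(3) by (simp_all add: partial_order_on_def preorder_on_def)
  have blocks: "blocks_at ?D s = blocks_at D s" if "s \<in> W" for s
    using block that by (auto simp: blocks_at_def)
  have agree: "(A, B) \<in> ?r \<longleftrightarrow> (A, B) \<in> r"
    if "A \<in> blocks_at ?D s \<union> blocks_at ?D t" "B \<in> blocks_at ?D s \<union> blocks_at ?D t" for A B s t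
    using that by (auto simp: blocks_at_def)
  have agree1: "(A, B) \<in> ?r \<longleftrightarrow> (A, B) \<in> r" if "A \<in> blocks_at ?D s" "B \<in> blocks_at ?D s" for A B s
    using that by (auto simp: blocks_at_def)
  show ?thesis
  proof (rule staircase_diagramI; (unfold pverts_induced in_parcs_induced)?)
    show "B \<noteq> {}" "B \<subseteq> W" if "B \<in> ?D" for B
      using that d(1) by auto
    have "refl_on ?D ?r"
      using po(1) by (auto simp: refl_on_def)
    moreover have "trans ?r"
      using po(2) by (auto intro!: transI dest: transD)
    moreover have "antisym ?r"
      using po(3) by (auto intro!: antisymI dest: antisymD)
    ultimately show "partial_order_on ?D ?r"
      using r by (auto simp: partial_order_on_def preorder_on_def)
    show "connected_in ?H B" if "B \<in> ?D" for B
      using that d(4) by (simp add: connected_in_induced)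
    show "connected_in ?H (B \<union> B')" if c: "covers ?D ?r B B'" for B B'
    proof -
      \<comment> \<open>Any \<open>z\<close> below \<open>B\<close> lies in \<open>W\<close> by
        \<open>rel\<close>, so it would already have been a rival in the restricted poset.\<close>
      have "z = B' \<or> z = B" if "z \<in> D" "(B', z) \<in> r" "(z, B) \<in> r" for z
        using c that rel[OF that(3)] by (auto simp: covers_def)
      with c have "covers D r B B'"
        by (auto simp: covers_def)
      moreover have "B \<union> B' \<subseteq> W"
        using covers_in[OF c] by auto
      ultimately show ?thesis
        using d(5) by (simp add: connected_in_induced)
    qed
    show "blocks_at ?D s \<in> Chains ?r" if "s \<in> W" for s
      by (rule Chains_cong[THEN iffD2, rotated], simp only: blocks that, rule d(6),
          rule subsetD[OF W that], erule (1) agree1)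
    show "blocks_at ?D s \<union> blocks_at ?D t \<in> Chains ?r"
      if st: "(s, t) \<in> parcs G \<and> s \<in> W \<and> t \<in> W" for s t
    proof (rule Chains_cong[THEN iffD2, rotated])
      show "blocks_at ?D s \<union> blocks_at ?D t \<in> Chains r"
        using st d(7) by (simp add: blocks)
    qed (erule (1) agree)
    show "saturated_subchain (blocks_at ?D s \<union> blocks_at ?D t) ?r (blocks_at ?D s)"
      if st: "(s, t) \<in> parcs G \<and> s \<in> W \<and> t \<in> W" for s t
    proof (rule saturated_subchain_cong)
      show "saturated_subchain (blocks_at ?D s \<union> blocks_at ?D t) r (blocks_at ?D s)"
        using st d(8) by (simp add: blocks)
    qed (erule (1) agree)
    show "saturated_subchain (blocks_at ?D s \<union> blocks_at ?D t) ?r (blocks_at ?D t)"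
      if st: "(s, t) \<in> parcs G \<and> s \<in> W \<and> t \<in> W" for s t
    proof (rule saturated_subchain_cong)
      show "saturated_subchain (blocks_at ?D s \<union> blocks_at ?D t) r (blocks_at ?D t)"
        using st d(9) by (simp add: blocks)
    qed (erule (1) agree)
    show "\<exists>s\<in>W. is_minimum ?r (blocks_at ?D s) B" if B: "B \<in> ?D" for B
    proof -
      obtain s where min: "is_minimum r (blocks_at D s) B"
        using d(10) B by blast
      then have s: "s \<in> W"
        using B by (auto simp: is_minimum_def blocks_at_def)
      have "is_minimum ?r (blocks_at ?D s) B"
        by (rule is_minimum_cong[where r = r], simp only: blocks s min, erule (1) agree1)
      with s show ?thesis ..
    qed
    show "\<exists>s\<in>W. is_maximum ?r (blocks_at ?D s) B" if B: "B \<in> ?D" for B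
    proof -
      obtain s where max: "is_maximum r (blocks_at D s) B"
        using d(11) B by blast
      then have s: "s \<in> W"
        using B by (auto simp: is_maximum_def blocks_at_def)
      have "is_maximum ?r (blocks_at ?D s) B"
        by (rule is_maximum_cong[where r = r], simp only: blocks s max, erule (1) agree1)
      with s show ?thesis ..
    qed
  qed
qed

section \<open>Gluing diagrams on two separated vertex sets\<close>

lemma partial_order_on_Un:
  assumes "partial_order_on A r" "partial_order_on B s" and disj: "A \<inter> B = {}"
  shows "partial_order_on (A \<union> B) (r \<union> s)"
proof -
  have r: "r \<subseteq> A \<times> A" "refl_on A r" "trans r" "antisym r"
    and s: "s \<subseteq> B \<times> B" "refl_on B s" "trans s" "antisym s"
    using assms(1,2) by (simp_all add: partial_order_on_def preorder_on_def)
  have "trans (r \<union> s)"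
  proof (rule transI)
    fix x y z
    assume "(x, y) \<in> r \<union> s" "(y, z) \<in> r \<union> s"
    then have "(x, y) \<in> r \<and> (y, z) \<in> r \<or> (x, y) \<in> s \<and> (y, z) \<in> s"
      using r(1) s(1) disj by blast
    then show "(x, z) \<in> r \<union> s"
      using r(3) s(3) by (auto dest: transD)
  qed
  moreover have "antisym (r \<union> s)"
  proof (rule antisymI)
    fix x y
    assume "(x, y) \<in> r \<union> s" "(y, x) \<in> r \<union> s"
    then have "(x, y) \<in> r \<and> (y, x) \<in> r \<or> (x, y) \<in> s \<and> (y, x) \<in> s"
      using r(1) s(1) disj by blast
    then show "x = y"
      using r(4) s(4) by (auto dest: antisymD)
  qed
  moreover have "refl_on (A \<union> B) (r \<union> s)"
    using r(2) s(2) by (auto simp: refl_on_def)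
  ultimately show ?thesis
    using r(1) s(1) by (auto simp: partial_order_on_def preorder_on_def)
qed

text \<open>The union of the relations leaves blocks of different parts incomparable. As no edge
  crosses, each axiom about vertices, edges or covers concerns a single part, where
  \<open>?r\<close> agrees with the relation of that part.\<close>

lemma staircase_diagram_Un:
  assumes sd1: "staircase_diagram (induced G W1) D1 r1"
    and sd2: "staircase_diagram (induced G W2) D2 r2"
    and disj: "W1 \<inter> W2 = {}"
    and cross: "\<And>x y. x \<in> W1 \<Longrightarrow> y \<in> W2 \<Longrightarrow> (x, y) \<notin> parcs G \<and> (y, x) \<notin> parcs G"
  shows "staircase_diagram (induced G (W1 \<union> W2)) (D1 \<union> D2) (r1 \<union> r2)"
    (is "staircase_diagram ?H ?D ?r")
proof -
  note d1 = staircase_diagramD[OF sd1, unfolded pverts_induced in_parcs_induced]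
  note d2 = staircase_diagramD[OF sd2, unfolded pverts_induced in_parcs_induced]
  have r1: "r1 \<subseteq> D1 \<times> D1" and r2: "r2 \<subseteq> D2 \<times> D2"
    using d1(3) d2(3) by (simp_all add: partial_order_on_def preorder_on_def)
  \<comment> \<open>Nonemptiness of blocks is essential: the empty set would be a subset of both
    parts.\<close>
  have D_disj: "D1 \<inter> D2 = {}"
    using d1(1,2) d2(2) disj by blast
  have blocks1: "blocks_at ?D s = blocks_at D1 s" if "s \<in> W1" for s
    using d2(2) that disj by (auto simp: blocks_at_def)
  have blocks2: "blocks_at ?D s = blocks_at D2 s" if "s \<in> W2" for s
    using d1(2) that disj by (auto simp: blocks_at_def)
  have rel1: "(A, B) \<in> ?r \<longleftrightarrow> (A, B) \<in> r1" if "A \<in> D1" for A B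
    using that r2 D_disj by blast
  have rel2: "(A, B) \<in> ?r \<longleftrightarrow> (A, B) \<in> r2" if "A \<in> D2" for A B
    using that r1 D_disj by blast
  have agree1: "(A, B) \<in> ?r \<longleftrightarrow> (A, B) \<in> r1" if "A \<in> blocks_at D1 s \<union> blocks_at D1 t" for A B s t
    using that by (intro rel1) (auto simp: blocks_at_def)
  have agree2: "(A, B) \<in> ?r \<longleftrightarrow> (A, B) \<in> r2" if "A \<in> blocks_at D2 s \<union> blocks_at D2 t" for A B s t
    using that by (intro rel2) (auto simp: blocks_at_def)
  \<comment> \<open>The lower block \<open>B\<close> decides the part: \<open>?r\<close> never joins
    \<open>D1\<close> to \<open>D2\<close>, so \<open>A\<close> follows, and an intermediate block
    of that part would also be intermediate in the union.\<close>
  have cov: "covers D1 r1 A B \<or> covers D2 r2 A B" if c: "covers ?D ?r A B" for A B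
  proof (cases "B \<in> D1")
    case True
    then have "(B, A) \<in> r1" using c rel1 by (auto simp: covers_def)
    moreover from this have "A \<in> D1" using r1 by blast
    moreover have "z = B \<or> z = A" if "z \<in> D1" "(B, z) \<in> r1" "(z, A) \<in> r1" for z
      using c that by (auto simp: covers_def)
    ultimately show ?thesis
      using True c by (auto simp: covers_def)
  next
    case False
    then have "B \<in> D2" using covers_in[OF c] by blast
    then have "(B, A) \<in> r2" using c rel2 by (auto simp: covers_def)
    moreover from this have "A \<in> D2" using r2 by blast
    moreover have "z = B \<or> z = A" if "z \<in> D2" "(B, z) \<in> r2" "(z, A) \<in> r2" for z
      using c that by (auto simp: covers_def)
    ultimately show ?thesis
      using \<open>B \<in> D2\<close> c by (auto simp: covers_def)
  qed
  have conn: "connected_in ?H B" if "B \<subseteq> W" "connected_in (induced G W) B" "W = W1 \<or> W = W2" for B W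
  proof -
    have "B \<subseteq> W1 \<union> W2" using that(1,3) by blast
    then show ?thesis using that(1,2) by (simp add: connected_in_induced)
  qed
  have edge: "blocks_at ?D s \<union> blocks_at ?D t \<in> Chains ?r \<and>
      saturated_subchain (blocks_at ?D s \<union> blocks_at ?D t) ?r (blocks_at ?D s) \<and>
      saturated_subchain (blocks_at ?D s \<union> blocks_at ?D t) ?r (blocks_at ?D t)"
    if "(s, t) \<in> parcs G" "s \<in> W1 \<union> W2" "t \<in> W1 \<union> W2" for s t
  proof -
    have "s \<in> W1 \<and> t \<in> W1 \<or> s \<in> W2 \<and> t \<in> W2"
      using that cross by blast
    then consider "s \<in> W1" "t \<in> W1" | "s \<in> W2" "t \<in> W2"
      by blast
    then show ?thesis
    proof cases
      case 1
      then have st: "(s, t) \<in> parcs G \<and> s \<in> W1 \<and> t \<in> W1" using that(1) by simp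
      show ?thesis
        unfolding blocks1[OF 1(1)] blocks1[OF 1(2)]
        by (intro conjI)
          (rule Chains_cong[THEN iffD2, rotated], rule d1(7)[OF st], erule agree1,
           rule saturated_subchain_cong[OF d1(8)[OF st]], erule agree1,
           rule saturated_subchain_cong[OF d1(9)[OF st]], erule agree1)
    next
      case 2
      then have st: "(s, t) \<in> parcs G \<and> s \<in> W2 \<and> t \<in> W2" using that(1) by simp
      show ?thesis
        unfolding blocks2[OF 2(1)] blocks2[OF 2(2)]
        by (intro conjI)
          (rule Chains_cong[THEN iffD2, rotated], rule d2(7)[OF st], erule agree2,
           rule saturated_subchain_cong[OF d2(8)[OF st]], erule agree2,
           rule saturated_subchain_cong[OF d2(9)[OF st]], erule agree2)
    qed
  qed
  have agree1': "(A, B) \<in> ?r \<longleftrightarrow> (A, B) \<in> r1" if "A \<in> blocks_at D1 s" for A B s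
    using that agree1[of A s s] by simp
  have agree2': "(A, B) \<in> ?r \<longleftrightarrow> (A, B) \<in> r2" if "A \<in> blocks_at D2 s" for A B s
    using that agree2[of A s s] by simp
  show ?thesis
  proof (rule staircase_diagramI; (unfold pverts_induced in_parcs_induced)?)
    show "B \<noteq> {}" "B \<subseteq> W1 \<union> W2" if "B \<in> ?D" for B
      using that d1(1,2) d2(1,2) by blast+
    show "partial_order_on ?D ?r"
      by (rule partial_order_on_Un[OF d1(3) d2(3) D_disj])
    show "connected_in ?H B" if "B \<in> ?D" for B
      using that d1(2,4) d2(2,4) conn by (metis UnE)
    show "connected_in ?H (B \<union> B')" if c: "covers ?D ?r B B'" for B B'
      using cov[OF c]
    proof
      assume c: "covers D1 r1 B B'"
      show ?thesis
        by (rule conn[OF _ d1(5)[OF c]]) (use covers_in[OF c] d1(2) in auto)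
    next
      assume c: "covers D2 r2 B B'"
      show ?thesis
        by (rule conn[OF _ d2(5)[OF c]]) (use covers_in[OF c] d2(2) in auto)
    qed
    show "blocks_at ?D s \<in> Chains ?r" if "s \<in> W1 \<union> W2" for s
      using that
    proof
      assume s: "s \<in> W1"
      show ?thesis
        unfolding blocks1[OF s]
        by (rule Chains_cong[THEN iffD2, rotated], rule d1(6)[OF s], erule agree1')
    next
      assume s: "s \<in> W2"
      show ?thesis
        unfolding blocks2[OF s]
        by (rule Chains_cong[THEN iffD2, rotated], rule d2(6)[OF s], erule agree2')
    qed
    show "\<exists>s\<in>W1 \<union> W2. is_minimum ?r (blocks_at ?D s) B" if "B \<in> ?D" for B
      using that
    proof
      assume "B \<in> D1"
      then obtain s where s: "s \<in> W1" "is_minimum r1 (blocks_at D1 s) B"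
        using d1(10) by blast
      have "is_minimum ?r (blocks_at ?D s) B"
        unfolding blocks1[OF s(1)] by (rule is_minimum_cong[OF s(2)], erule agree1')
      with s(1) show ?thesis by blast
    next
      assume "B \<in> D2"
      then obtain s where s: "s \<in> W2" "is_minimum r2 (blocks_at D2 s) B"
        using d2(10) by blast
      have "is_minimum ?r (blocks_at ?D s) B"
        unfolding blocks2[OF s(1)] by (rule is_minimum_cong[OF s(2)], erule agree2')
      with s(1) show ?thesis by blast
    qed
    show "\<exists>s\<in>W1 \<union> W2. is_maximum ?r (blocks_at ?D s) B" if "B \<in> ?D" for B
      using that
    proof
      assume "B \<in> D1"
      then obtain s where s: "s \<in> W1" "is_maximum r1 (blocks_at D1 s) B"
        using d1(11) by blast
      have "is_maximum ?r (blocks_at ?D s) B"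
        unfolding blocks1[OF s(1)] by (rule is_maximum_cong[OF s(2)], erule agree1')
      with s(1) show ?thesis by blast
    next
      assume "B \<in> D2"
      then obtain s where s: "s \<in> W2" "is_maximum r2 (blocks_at D2 s) B"
        using d2(11) by blast
      have "is_maximum ?r (blocks_at ?D s) B"
        unfolding blocks2[OF s(1)] by (rule is_maximum_cong[OF s(2)], erule agree2')
      with s(1) show ?thesis by blast
    qed
  qed (use edge in blast)+
qed


section \<open>Splitting a diagram over separated vertex sets, and the product formula\<close>

text \<open>Connectedness puts each block, and each union of a covering pair, on one side. For a
  comparable pair that is not covering, an intermediate block passes the side from one end to the
  other.\<close>

lemma staircase_diagram_same_side:
  assumes sd: "staircase_diagram (induced G (W1 \<union> W2)) D r"
    and fin: "finite (W1 \<union> W2)"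
    and disj: "W1 \<inter> W2 = {}"
    and cross: "\<And>x y. x \<in> W1 \<Longrightarrow> y \<in> W2 \<Longrightarrow> (x, y) \<notin> parcs G \<and> (y, x) \<notin> parcs G"
  shows "\<And>B. B \<in> D \<Longrightarrow> B \<subseteq> W1 \<or> B \<subseteq> W2"
    and "\<And>A B. (A, B) \<in> r \<Longrightarrow> A \<subseteq> W1 \<and> B \<subseteq> W1 \<or> A \<subseteq> W2 \<and> B \<subseteq> W2"
proof -
  note d = staircase_diagramD[OF sd, unfolded pverts_induced in_parcs_induced]
  have r: "r \<subseteq> D \<times> D" and po: "refl_on D r" "trans r" "antisym r"
    using d(3) by (simp_all add: partial_order_on_def preorder_on_def)
  have "finite D"
    by (rule finite_subset[of _ "Pow (W1 \<union> W2)"]) (use d(2) fin in auto)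
  have side: "X \<subseteq> W1 \<or> X \<subseteq> W2" if conn: "connected_in (induced G (W1 \<union> W2)) X" and X: "X \<subseteq> W1 \<union> W2" for X
  proof (cases "\<exists>b. b \<in> X \<and> b \<in> W1")
    case True
    then obtain b where "b \<in> X" "b \<in> W1" by blast
    then have "X \<subseteq> W1"
      by (rule connected_in_subset[OF conn]) (use X cross in auto)
    then show ?thesis ..
  qed (use X in blast)
  show block: "B \<subseteq> W1 \<or> B \<subseteq> W2" if "B \<in> D" for B
    using side d(2,4) that by blast
  show "A \<subseteq> W1 \<and> B \<subseteq> W1 \<or> A \<subseteq> W2 \<and> B \<subseteq> W2" if "(A, B) \<in> r" for A B
    using that
  \<comment> \<open>The measure is the number of blocks in the closed interval from \<open>A\<close>
    to \<open>B\<close>, finite because \<open>D\<close> is.\<close>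
  proof (induction "card {z \<in> D. (A, z) \<in> r \<and> (z, B) \<in> r}" arbitrary: A B rule: less_induct)
    case less
    have AB: "A \<in> D" "B \<in> D"
      using less.prems r by auto
    show ?case
    proof (cases "A = B \<or> covers D r B A")
      case True
      then have "A \<union> B \<subseteq> W1 \<or> A \<union> B \<subseteq> W2"
      proof
        assume "covers D r B A"
        then have "B \<union> A \<subseteq> W1 \<or> B \<union> A \<subseteq> W2"
          using AB d(2) by (intro side d(5)) auto
        then show ?thesis by blast
      qed (use block AB in auto)
      then show ?thesis by blast
    next
      case False
      then obtain z where z: "z \<in> D" "z \<noteq> A" "z \<noteq> B" "(A, z) \<in> r" "(z, B) \<in> r"
        using less.prems AB unfolding covers_def by blast
      \<comment> \<open>Antisymmetry expels \<open>A\<close> from the interval above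
        \<open>z\<close>, and below it expels \<open>B\<close> from the interval under
        \<open>z\<close>; both halves are strictly smaller.\<close>
      have "A \<notin> {y \<in> D. (z, y) \<in> r \<and> (y, B) \<in> r}"
        using z po(3) by (auto dest: antisymD)
      moreover have "{y \<in> D. (z, y) \<in> r \<and> (y, B) \<in> r} \<subseteq> {y \<in> D. (A, y) \<in> r \<and> (y, B) \<in> r}"
        using z(4) po(2) by (auto dest: transD)
      moreover have "A \<in> {y \<in> D. (A, y) \<in> r \<and> (y, B) \<in> r}"
        using AB less.prems po(1) by (auto simp: refl_on_def)
      ultimately have "card {y \<in> D. (z, y) \<in> r \<and> (y, B) \<in> r} < card {y \<in> D. (A, y) \<in> r \<and> (y, B) \<in> r}"
        using \<open>finite D\<close> by (intro psubset_card_mono) auto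
      from less.hyps[OF this z(5)] have zB: "z \<subseteq> W1 \<and> B \<subseteq> W1 \<or> z \<subseteq> W2 \<and> B \<subseteq> W2" .
      have "B \<notin> {y \<in> D. (A, y) \<in> r \<and> (y, z) \<in> r}"
        using z po(3) by (auto dest: antisymD)
      moreover have "{y \<in> D. (A, y) \<in> r \<and> (y, z) \<in> r} \<subseteq> {y \<in> D. (A, y) \<in> r \<and> (y, B) \<in> r}"
        using z(5) po(2) by (auto dest: transD)
      moreover have "B \<in> {y \<in> D. (A, y) \<in> r \<and> (y, B) \<in> r}"
        using AB less.prems po(1) by (auto simp: refl_on_def)
      ultimately have "card {y \<in> D. (A, y) \<in> r \<and> (y, z) \<in> r} < card {y \<in> D. (A, y) \<in> r \<and> (y, B) \<in> r}"
        using \<open>finite D\<close> by (intro psubset_card_mono) auto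
      from less.hyps[OF this z(4)] have "A \<subseteq> W1 \<and> z \<subseteq> W1 \<or> A \<subseteq> W2 \<and> z \<subseteq> W2" .
      \<comment> \<open>Being nonempty, \<open>z\<close> has only one side, so the two induction
        hypotheses name the same one.\<close>
      moreover have "\<not> (z \<subseteq> W1 \<and> z \<subseteq> W2)"
        using d(1)[OF z(1)] disj by blast
      ultimately show ?thesis
        using zB by blast
    qed
  qed
qed

lemma staircase_diagrams_inducedD:
  assumes "(D, r) \<in> staircase_diagrams (induced G W)"
  shows "D \<subseteq> Pow W" "{} \<notin> D" "r \<subseteq> D \<times> D"
proof -
  from assms have sd: "staircase_diagram (induced G W) D r"
    by (simp add: staircase_diagrams_def)
  show "D \<subseteq> Pow W" "{} \<notin> D" "r \<subseteq> D \<times> D"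
    using staircase_diagramD(1,2,3)[OF sd] by (auto simp: partial_order_on_def preorder_on_def)
qed

text \<open>Intersecting with \<open>Pow W1\<close> and \<open>Pow W2\<close> inverts the union. No
  block is lost since each has a side, no comparability is lost since comparable blocks share it,
  and none is counted twice since blocks are nonempty.\<close>

lemma bij_betw_staircase_diagrams_Un:
  assumes fin: "finite (W1 \<union> W2)"
    and disj: "W1 \<inter> W2 = {}"
    and cross: "\<And>x y. x \<in> W1 \<Longrightarrow> y \<in> W2 \<Longrightarrow> (x, y) \<notin> parcs G \<and> (y, x) \<notin> parcs G"
  shows "bij_betw (\<lambda>((D1, r1), (D2, r2)). (D1 \<union> D2, r1 \<union> r2))
    (staircase_diagrams (induced G W1) \<times> staircase_diagrams (induced G W2))
    (staircase_diagrams (induced G (W1 \<union> W2)))"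
    (is "bij_betw ?f (?S1 \<times> ?S2) ?S")
proof (rule bij_betw_byWitness)
  let ?g = "\<lambda>(D, r). ((D \<inter> Pow W1, r \<inter> (Pow W1 \<times> Pow W1)), (D \<inter> Pow W2, r \<inter> (Pow W2 \<times> Pow W2)))"
  show "\<forall>p\<in>?S1 \<times> ?S2. ?g (?f p) = p"
  proof
    fix p
    assume "p \<in> ?S1 \<times> ?S2"
    then obtain D1 r1 D2 r2 where p: "p = ((D1, r1), (D2, r2))"
      and S: "(D1, r1) \<in> ?S1" "(D2, r2) \<in> ?S2"
      by auto
    note s = staircase_diagrams_inducedD[OF S(1)] staircase_diagrams_inducedD[OF S(2)]
    have D1: "A \<subseteq> W1 \<and> \<not> A \<subseteq> W2" if "A \<in> D1" for A
    proof -
      have "A \<noteq> {}" "A \<subseteq> W1" using that s(1,2) by auto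
      then show ?thesis using disj by blast
    qed
    have D2: "A \<subseteq> W2 \<and> \<not> A \<subseteq> W1" if "A \<in> D2" for A
    proof -
      have "A \<noteq> {}" "A \<subseteq> W2" using that s(4,5) by auto
      then show ?thesis using disj by blast
    qed
    have "(D1 \<union> D2) \<inter> Pow W1 = D1" "(D1 \<union> D2) \<inter> Pow W2 = D2"
      using D1 D2 by auto
    moreover have "(r1 \<union> r2) \<inter> (Pow W1 \<times> Pow W1) = r1" "(r1 \<union> r2) \<inter> (Pow W2 \<times> Pow W2) = r2"
      using D1 D2 s(3,6) by auto
    ultimately show "?g (?f p) = p"
      by (simp add: p)
  qed
  have side: "B \<in> D \<Longrightarrow> B \<subseteq> W1 \<or> B \<subseteq> W2"
      "(A, B) \<in> r \<Longrightarrow> A \<subseteq> W1 \<and> B \<subseteq> W1 \<or> A \<subseteq> W2 \<and> B \<subseteq> W2"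
    if "(D, r) \<in> ?S" for D r A B
    using staircase_diagram_same_side[OF _ fin disj cross, of D r] that
    by (simp_all add: staircase_diagrams_def)
  show "\<forall>p\<in>?S. ?f (?g p) = p"
  proof
    fix p
    assume "p \<in> ?S"
    then obtain D r where p: "p = (D, r)" and S: "(D, r) \<in> ?S"
      by (cases p) auto
    have "D \<inter> Pow W1 \<union> D \<inter> Pow W2 = D"
      using side(1)[OF S] by auto
    moreover have "r \<inter> (Pow W1 \<times> Pow W1) \<union> r \<inter> (Pow W2 \<times> Pow W2) = r"
      using side(2)[OF S] by auto
    ultimately show "?f (?g p) = p"
      by (simp add: p)
  qed
  show "?f ` (?S1 \<times> ?S2) \<subseteq> ?S"
    using staircase_diagram_Un[OF _ _ disj cross] by (auto simp: staircase_diagrams_def)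
  show "?g ` ?S \<subseteq> ?S1 \<times> ?S2"
  proof
    fix p
    assume "p \<in> ?g ` ?S"
    then obtain D r where p: "p = ?g (D, r)" and S: "(D, r) \<in> ?S"
      by auto
    from S have sd: "staircase_diagram (induced G (W1 \<union> W2)) D r"
      by (simp add: staircase_diagrams_def)
    note s = staircase_diagrams_inducedD[OF S]
    have not_both: "\<not> (B \<subseteq> W1 \<and> B \<subseteq> W2)" if "B \<in> D" for B
    proof -
      have "B \<noteq> {}" using that s(2) by auto
      then show ?thesis using disj by blast
    qed
    have rel: "A \<subseteq> W1 \<longleftrightarrow> B \<subseteq> W1" "A \<subseteq> W2 \<longleftrightarrow> B \<subseteq> W2" if "(A, B) \<in> r" for A B
      using side(2)[OF S that] not_both[of A] not_both[of B] that s(3) by auto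
    have block: "B \<subseteq> W1 \<or> B \<inter> W1 = {}" "B \<subseteq> W2 \<or> B \<inter> W2 = {}" if "B \<in> D" for B
      using side(1)[OF S that] disj by blast+
    have "staircase_diagram (induced (induced G (W1 \<union> W2)) W1) (D \<inter> Pow W1) (r \<inter> (Pow W1 \<times> Pow W1))"
      by (rule staircase_diagram_component[OF sd]) (use block rel in simp_all)
    moreover have "staircase_diagram (induced (induced G (W1 \<union> W2)) W2) (D \<inter> Pow W2) (r \<inter> (Pow W2 \<times> Pow W2))"
      by (rule staircase_diagram_component[OF sd]) (use block rel in simp_all)
    ultimately show "p \<in> ?S1 \<times> ?S2"
      by (simp add: p staircase_diagrams_def)
  qed
qed

lemma diagram_count_Un:
  assumes "finite (W1 \<union> W2)" "W1 \<inter> W2 = {}"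
    and "\<And>x y. x \<in> W1 \<Longrightarrow> y \<in> W2 \<Longrightarrow> (x, y) \<notin> parcs G \<and> (y, x) \<notin> parcs G"
  shows "diagram_count G (W1 \<union> W2) = diagram_count G W1 * diagram_count G W2"
  using bij_betw_same_card[OF bij_betw_staircase_diagrams_Un[OF assms]]
  by (simp add: diagram_count_def card_cartesian_product)

text \<open>Under the union bijection, covering \<open>W1\<close> is a condition on the first factor
  alone, because the blocks of the second factor avoid \<open>W1\<close>.\<close>

lemma card_full_on_Un:
  assumes fin: "finite (W1 \<union> W2)" and disj: "W1 \<inter> W2 = {}"
    and cross: "\<And>x y. x \<in> W1 \<Longrightarrow> y \<in> W2 \<Longrightarrow> (x, y) \<notin> parcs G \<and> (y, x) \<notin> parcs G"
  shows "card {(D, r) \<in> staircase_diagrams (induced G (W1 \<union> W2)). W1 \<subseteq> \<Union>D} =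
    card (full_staircase_diagrams (induced G W1)) * diagram_count G W2"
proof -
  let ?f = "\<lambda>((D1, r1), (D2, r2)). (D1 \<union> D2, r1 \<union> r2)"
  let ?S = "staircase_diagrams (induced G (W1 \<union> W2))"
  let ?F = "full_staircase_diagrams (induced G W1)"
  let ?S2 = "staircase_diagrams (induced G W2)"
  have bij: "bij_betw ?f (staircase_diagrams (induced G W1) \<times> ?S2) ?S"
    by (rule bij_betw_staircase_diagrams_Un[OF fin disj]) (rule cross)
  have sub: "?F \<times> ?S2 \<subseteq> staircase_diagrams (induced G W1) \<times> ?S2"
    by (auto simp: full_staircase_diagrams_def staircase_diagrams_def)
  have full: "W1 \<subseteq> \<Union>(D1 \<union> D2) \<longleftrightarrow> (D1, r1) \<in> ?F"
    if S1: "(D1, r1) \<in> staircase_diagrams (induced G W1)" and S2: "(D2, r2) \<in> ?S2" for D1 r1 D2 r2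
  proof -
    have "\<Union>D1 \<subseteq> W1" "\<Union>D2 \<subseteq> W2"
      using staircase_diagrams_inducedD(1)[OF S1] staircase_diagrams_inducedD(1)[OF S2] by auto
    then have "W1 \<subseteq> \<Union>(D1 \<union> D2) \<longleftrightarrow> \<Union>D1 = W1"
      unfolding Union_Un_distrib using disj by blast
    then show ?thesis
      using S1 by (simp add: full_staircase_diagrams_def staircase_diagrams_def fully_supported_def)
  qed
  have img: "?f ` (?F \<times> ?S2) = {(D, r) \<in> ?S. W1 \<subseteq> \<Union>D}"
  proof (intro equalityI subsetI)
    fix p
    assume "p \<in> ?f ` (?F \<times> ?S2)"
    then obtain D1 r1 D2 r2 where p: "p = (D1 \<union> D2, r1 \<union> r2)" "(D1, r1) \<in> ?F" "(D2, r2) \<in> ?S2"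
      by auto
    then have "((D1, r1), (D2, r2)) \<in> staircase_diagrams (induced G W1) \<times> ?S2"
      using sub by auto
    then have "?f ((D1, r1), (D2, r2)) \<in> ?S"
      using bij_betwE[OF bij] by blast
    moreover have "W1 \<subseteq> \<Union>(D1 \<union> D2)"
      using full p sub by blast
    ultimately show "p \<in> {(D, r) \<in> ?S. W1 \<subseteq> \<Union>D}"
      by (simp add: p)
  next
    fix p
    assume "p \<in> {(D, r) \<in> ?S. W1 \<subseteq> \<Union>D}"
    then have "p \<in> ?S" and W1: "W1 \<subseteq> \<Union>(fst p)"
      by (simp_all add: case_prod_beta)
    then obtain q where q: "q \<in> staircase_diagrams (induced G W1) \<times> ?S2" "p = ?f q"
      using bij_betw_imp_surj_on[OF bij] by blast
    obtain D1 r1 D2 r2 where q': "q = ((D1, r1), (D2, r2))"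
      by (metis surj_pair)
    with q have S: "(D1, r1) \<in> staircase_diagrams (induced G W1)" "(D2, r2) \<in> ?S2"
      by simp_all
    have "W1 \<subseteq> \<Union>(D1 \<union> D2)"
      using W1 unfolding q(2) q' by simp
    then have "q \<in> ?F \<times> ?S2"
      using full[OF S] S(2) by (simp add: q')
    then show "p \<in> ?f ` (?F \<times> ?S2)"
      unfolding q(2) by (rule imageI)
  qed
  have "inj_on ?f (?F \<times> ?S2)"
    by (rule inj_on_subset[OF bij_betw_imp_inj_on[OF bij] sub])
  then have "card {(D, r) \<in> ?S. W1 \<subseteq> \<Union>D} = card (?F \<times> ?S2)"
    unfolding img[symmetric] by (rule card_image)
  then show ?thesis
    by (simp add: card_cartesian_product diagram_count_def)
qed

section \<open>Paths and the Dynkin graph\<close>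

lemma in_parcs_path_graph:
  "(x, y) \<in> parcs (path_graph n) \<longleftrightarrow>
    x \<in> {1..n} \<and> y \<in> {1..n} \<and> (y = x + 1 \<or> x = y + 1)"
  by (auto simp: path_graph_def)

lemma in_parcs_D_graph:
  "(x, y) \<in> parcs (D_graph n) \<longleftrightarrow>
    x \<in> {2..n} \<and> y \<in> {2..n} \<and> (y = x + 1 \<or> x = y + 1) \<or> x = 1 \<and> y = 3 \<or> x = 3 \<and> y = 1"
  by (auto simp: D_graph_def)

lemma pverts_path_graph [simp]: "pverts (path_graph n) = {1..n}"
  by (simp add: path_graph_def)

lemma pverts_D_graph [simp]: "pverts (D_graph n) = {1..n}"
  by (simp add: D_graph_def)

text \<open>Here \<open>f\<close> lists the vertices of \<open>W\<close> in path order, so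
  recognising a path inside a larger graph amounts to checking adjacency.\<close>

lemma diagram_count_path:
  assumes "inj_on f {1..m}" "W = f ` {1..m}"
    and "\<And>x y. x \<in> {1..m} \<Longrightarrow> y \<in> {1..m} \<Longrightarrow> (f x, f y) \<in> parcs G \<longleftrightarrow> y = x + 1 \<or> x = y + 1"
  shows "diagram_count G W = path_count m"
  unfolding diagram_count_def path_count_def
proof (rule card_staircase_diagrams_iso[symmetric])
  show "inj_on f (pverts (path_graph m))" "pverts (induced G W) = f ` pverts (path_graph m)"
    using assms(1,2) by simp_all
  show "(f x, f y) \<in> parcs (induced G W) \<longleftrightarrow> (x, y) \<in> parcs (path_graph m)"
    if "x \<in> pverts (path_graph m)" "y \<in> pverts (path_graph m)" for x y
    using that assms(2,3) by (auto simp: in_parcs_path_graph)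
  show "parcs (path_graph m) \<subseteq> pverts (path_graph m) \<times> pverts (path_graph m)"
    by (auto simp: in_parcs_path_graph)
  show "parcs (induced G W) \<subseteq> pverts (induced G W) \<times> pverts (induced G W)"
    by auto
qed simp

text \<open>The value serves twice: as the factor contributed by an isolated vertex, and in the
  coefficient of \<open>fps_X ^ 2\<close>, where \<open>2 * 2 - 1 = 3\<close>.\<close>

lemma path_count_1: "path_count 1 = 2"
proof -
  have "staircase_diagram (path_graph 1) D r \<longleftrightarrow> D = {} \<and> r = {} \<or> D = {{1}} \<and> r = {({1}, {1})}" for D r
  proof
    assume "staircase_diagram (path_graph 1) D r"
    note d = staircase_diagramD(1,2,3)[OF this]
    have "D \<subseteq> {{1}}"
      using d(1,2) by (auto simp: subset_singleton_iff)
    then have "D = {} \<or> D = {{1}}"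
      by auto
    moreover have "r \<subseteq> D \<times> D" "refl_on D r"
      using d(3) by (simp_all add: partial_order_on_def preorder_on_def)
    ultimately show "D = {} \<and> r = {} \<or> D = {{1}} \<and> r = {({1}, {1})}"
      by (auto simp: refl_on_def)
  next
    have "blocks_at {{1::nat}} 1 = {{1}}"
      by (auto simp: blocks_at_def)
    then have "staircase_diagram (path_graph 1) {{1}} {({1}, {1})}"
      by (intro staircase_diagramI)
        (auto simp: connected_in_iff covers_def partial_order_on_def preorder_on_def refl_on_def
          Chains_def is_minimum_def is_maximum_def in_parcs_path_graph intro: transI antisymI)
    moreover have "staircase_diagram (path_graph 1) {} {}"
      by (intro staircase_diagramI) (auto simp: covers_def blocks_at_def)
    ultimately show "staircase_diagram (path_graph 1) D r" if "D = {} \<and> r = {} \<or> D = {{1}} \<and> r = {({1}, {1})}"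
      using that by blast
  qed
  then have "staircase_diagrams (path_graph 1) = {({}, {}), ({{1}}, {({1}, {1})})}"
    by (auto simp: staircase_diagrams_def)
  then show ?thesis
    by (simp add: path_count_def)
qed

lemma diagram_count_singleton: "(x, x) \<notin> parcs G \<Longrightarrow> diagram_count G {x} = 2"
  using diagram_count_path[of "\<lambda>_. x" 1 "{x}" G] path_count_1 by (simp add: inj_on_def)

text \<open>With vertex 1 removed, only edges between consecutive labels survive. For
  \<open>k = n\<close> the set is empty and the count is \<open>path_count 0\<close>.\<close>

lemma diagram_count_D_tail: "1 \<le> k \<Longrightarrow> k \<le> n \<Longrightarrow> diagram_count (D_graph n) {Suc k..n} = path_count (n - k)"
proof (rule diagram_count_path)
  assume "1 \<le> k" "k \<le> n"
  show "{Suc k..n} = (\<lambda>x. x + k) ` {1..n - k}"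
    unfolding image_add_atLeastAtMost' using \<open>k \<le> n\<close> by simp
qed (auto simp: in_parcs_D_graph)

lemma diagram_count_D_minus_2:
  assumes "3 \<le> n"
  shows "diagram_count (D_graph n) ({1..n} - {2}) = path_count (n - 1)"
proof (rule diagram_count_path)
  \<comment> \<open>The remaining path runs 1, 3, 4, ..., \<open>n\<close>: the edge from 1 to 3
    takes the place of the one from 2 to 3.\<close>
  let ?f = "\<lambda>x::nat. if x = 1 then 1 else Suc x"
  show "inj_on ?f {1..n - 1}"
    by (auto simp: inj_on_def)
  show "{1..n} - {2} = ?f ` {1..n - 1}"
  proof (intro equalityI subsetI)
    fix x
    assume x: "x \<in> {1..n} - {2}"
    show "x \<in> ?f ` {1..n - 1}"
    proof (cases "x = 1")
      case True
      then show ?thesis using assms by (intro image_eqI[of _ _ 1]) auto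
    next
      case False
      then show ?thesis using x by (intro image_eqI[of _ _ "x - 1"]) auto
    qed
  qed (use assms in \<open>auto split: if_splits\<close>)
  show "(?f x, ?f y) \<in> parcs (D_graph n) \<longleftrightarrow> y = x + 1 \<or> x = y + 1"
    if "x \<in> {1..n - 1}" "y \<in> {1..n - 1}" for x y
    using that assms by (auto simp: in_parcs_D_graph)
qed

text \<open>Vertex 3 is the only neighbour of 1 and of 2. Without it they become isolated, and each
  one kept contributes a factor 2 next to the path on \<open>{4..n}\<close>.\<close>

lemma diagram_count_D_minus_3:
  assumes "3 \<le> n"
  shows "diagram_count (D_graph n) ({1..n} - {1, 3}) = 2 * path_count (n - 3)"
    and "diagram_count (D_graph n) ({1..n} - {2, 3}) = 2 * path_count (n - 3)"
    and "diagram_count (D_graph n) ({1..n} - {3}) = 4 * path_count (n - 3)"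
proof -
  have tail: "diagram_count (D_graph n) {4..n} = path_count (n - 3)"
    using diagram_count_D_tail[of 3 n] assms by simp
  have one: "diagram_count (D_graph n) {1} = 2" "diagram_count (D_graph n) {2} = 2"
    by (simp_all add: diagram_count_singleton in_parcs_D_graph)
  have "{1..n} - {1, 3} = {2} \<union> {4..n}" "{1..n} - {2, 3} = {1} \<union> {4..n}"
      "{1..n} - {3} = {1} \<union> ({2} \<union> {4..n})"
    using assms by auto
  moreover have two: "diagram_count (D_graph n) ({2} \<union> {4..n}) = 2 * path_count (n - 3)"
  proof -
    have "diagram_count (D_graph n) ({2} \<union> {4..n}) =
        diagram_count (D_graph n) {2} * diagram_count (D_graph n) {4..n}"
      by (rule diagram_count_Un) (auto simp: in_parcs_D_graph)
    then show ?thesis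
      unfolding one(2) tail .
  qed
  moreover have "diagram_count (D_graph n) ({1} \<union> {4..n}) = 2 * path_count (n - 3)"
  proof -
    have "diagram_count (D_graph n) ({1} \<union> {4..n}) =
        diagram_count (D_graph n) {1} * diagram_count (D_graph n) {4..n}"
      by (rule diagram_count_Un) (auto simp: in_parcs_D_graph)
    then show ?thesis
      unfolding one(1) tail .
  qed
  moreover have "diagram_count (D_graph n) ({1} \<union> ({2} \<union> {4..n})) = 4 * path_count (n - 3)"
  proof -
    have "diagram_count (D_graph n) ({1} \<union> ({2} \<union> {4..n})) =
        diagram_count (D_graph n) {1} * diagram_count (D_graph n) ({2} \<union> {4..n})"
      by (rule diagram_count_Un) (auto simp: in_parcs_D_graph)
    then show ?thesis
      unfolding one(1) two by simp
  qed
  ultimately show "diagram_count (D_graph n) ({1..n} - {1, 3}) = 2 * path_count (n - 3)"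
    "diagram_count (D_graph n) ({1..n} - {2, 3}) = 2 * path_count (n - 3)"
    "diagram_count (D_graph n) ({1..n} - {3}) = 4 * path_count (n - 3)"
    by metis+
qed

section \<open>Inclusion and exclusion over the fork\<close>

lemma card_Un3:
  assumes "finite A" "finite B" "finite C"
  shows "card (A \<union> B \<union> C) + card (A \<inter> B) + card (A \<inter> C) + card (B \<inter> C) =
    card A + card B + card C + card (A \<inter> B \<inter> C)"
proof -
  have "(A \<inter> C) \<inter> (B \<inter> C) = A \<inter> B \<inter> C" "(A \<union> B) \<inter> C = A \<inter> C \<union> B \<inter> C"
    by auto
  then show ?thesis
    \<comment> \<open>Three instances of the two-set identity; the additive form avoids truncated
      subtraction on \<open>nat\<close>.\<close>
    using card_Un_Int[of A B] card_Un_Int[of "A \<union> B" C] card_Un_Int[of "A \<inter> C" "B \<inter> C"] assms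
    by simp
qed

text \<open>Omitting 1 or 2 gives \<open>path_count (n - 1)\<close> each, and omitting both gives
  \<open>path_count (n - 2)\<close>. The sets containing 3 contribute multiples of
  \<open>path_count (n - 3)\<close>, namely \<open>4 - 2 - 2 + 1 = 1\<close>.\<close>

lemma card_D_not_full_on_fork:
  assumes n: "3 \<le> n"
  shows "int (card {(D, r) \<in> staircase_diagrams (D_graph n). \<not> {1, 2, 3} \<subseteq> \<Union>D}) =
    2 * int (path_count (n - 1)) - int (path_count (n - 2)) + int (path_count (n - 3))"
proof -
  let ?G = "D_graph n"
  define U where "U X = {(D, r). staircase_diagram ?G D r \<and> \<Union>D \<inter> X = {}}" for X
  have card_U: "card (U X) = diagram_count ?G ({1..n} - X)" for X
    unfolding U_def unsupported_eq_induced diagram_count_def by simp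
  have fin: "finite (U X)" for X
    by (rule finite_subset[OF _ finite_staircase_diagrams[of ?G]]) (auto simp: U_def staircase_diagrams_def)
  have Int: "U X \<inter> U Y = U (X \<union> Y)" for X Y
    by (auto simp: U_def)
  have sets: "{1..n} - {1} = {Suc 1..n}" "{1..n} - {1, 2} = {Suc 2..n}" "{1..n} - {1, 2, 3} = {Suc 3..n}"
    by auto
  have "card (U {1}) = path_count (n - 1)" "card (U {1, 2}) = path_count (n - 2)"
      "card (U {1, 2, 3}) = path_count (n - 3)"
    unfolding card_U sets using n by (intro diagram_count_D_tail; simp)+
  moreover have "card (U {2}) = path_count (n - 1)" "card (U {3}) = 4 * path_count (n - 3)"
      "card (U {1, 3}) = 2 * path_count (n - 3)" "card (U {2, 3}) = 2 * path_count (n - 3)"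
    unfolding card_U using n by (intro diagram_count_D_minus_2 diagram_count_D_minus_3; simp)+
  moreover have "U {1} \<inter> U {2} = U {1, 2}" "U {1} \<inter> U {3} = U {1, 3}" "U {2} \<inter> U {3} = U {2, 3}"
      "U {1, 2} \<inter> U {3} = U {1, 2, 3}"
    unfolding Int by (simp_all add: insert_commute)
  moreover have "{(D, r) \<in> staircase_diagrams ?G. \<not> {1, 2, 3} \<subseteq> \<Union>D} = U {1} \<union> U {2} \<union> U {3}"
    by (auto simp: U_def staircase_diagrams_def)
  ultimately show ?thesis
    using card_Un3[OF fin fin fin, of "{1}" "{2}" "{3}"] by simp
qed

section \<open>Decomposition at the first gap, and the recurrence\<close>

lemma card_D_first_gap:
  assumes i: "3 \<le> i" "i < n"
  shows "card {(D, r) \<in> staircase_diagrams (D_graph n). {1..i} \<subseteq> \<Union>D \<and> Suc i \<notin> \<Union>D} =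
    D_full_count i * path_count (n - 1 - i)"
proof -
  let ?G = "D_graph n"
  have W: "{1..n} - {Suc i} = {1..i} \<union> {Suc (Suc i)..n}"
    using i by auto
  have "{(D, r). staircase_diagram ?G D r \<and> \<Union>D \<inter> {Suc i} = {}} =
      staircase_diagrams (induced ?G ({1..i} \<union> {Suc (Suc i)..n}))"
    unfolding unsupported_eq_induced pverts_D_graph W ..
  then have "(D, r) \<in> staircase_diagrams ?G \<and> Suc i \<notin> \<Union>D \<longleftrightarrow>
      (D, r) \<in> staircase_diagrams (induced ?G ({1..i} \<union> {Suc (Suc i)..n}))" for D r
    unfolding set_eq_iff by (auto simp: staircase_diagrams_def)
  then have "{(D, r) \<in> staircase_diagrams ?G. {1..i} \<subseteq> \<Union>D \<and> Suc i \<notin> \<Union>D} =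
      {(D, r) \<in> staircase_diagrams (induced ?G ({1..i} \<union> {Suc (Suc i)..n})). {1..i} \<subseteq> \<Union>D}"
    by blast
  also have "card \<dots> = card (full_staircase_diagrams (induced ?G {1..i})) * diagram_count ?G {Suc (Suc i)..n}"
    by (rule card_full_on_Un) (use i in \<open>auto simp: in_parcs_D_graph\<close>)
  also have "induced ?G {1..i} = D_graph i"
  proof (rule pair_pre_digraph.equality)
    \<comment> \<open>The bound \<open>3 \<le> i\<close> matters here: it keeps both ends of the
      edge between 1 and 3 in the left part.\<close>
    have "(x, y) \<in> parcs (induced ?G {1..i}) \<longleftrightarrow> (x, y) \<in> parcs (D_graph i)" for x y
      unfolding in_parcs_induced in_parcs_D_graph atLeastAtMost_iff using i by linarith
    then show "parcs (induced ?G {1..i}) = parcs (D_graph i)"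
      by (intro equalityI subrelI) simp_all
  qed simp_all
  \<comment> \<open>The gap vertex itself accounts for the extra 1; for \<open>i = n - 1\<close> the
    right part is empty and counts once.\<close>
  also have "diagram_count ?G {Suc (Suc i)..n} = path_count (n - 1 - i)"
    using diagram_count_D_tail[of "Suc i" n] i by simp
  finally show ?thesis
    by (simp add: D_full_count_def)
qed

lemma D_count_rec:
  assumes n: "3 \<le> n"
  shows "int (D_count n) = int (D_full_count n)
    + (2 * int (path_count (n - 1)) - int (path_count (n - 2)) + int (path_count (n - 3)))
    + (\<Sum>i\<in>{3..<n}. int (D_full_count i) * int (path_count (n - 1 - i)))"
proof -
  let ?S = "staircase_diagrams (D_graph n)"
  define F where "F = full_staircase_diagrams (D_graph n)"
  define E where "E = {(D, r) \<in> ?S. \<not> {1, 2, 3} \<subseteq> \<Union>D}"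
  define P where "P i = {(D, r) \<in> ?S. {1..i} \<subseteq> \<Union>D \<and> Suc i \<notin> \<Union>D}" for i
  have fin: "finite ?S"
    by (rule finite_staircase_diagrams) simp
  have sub: "F \<subseteq> ?S" "E \<subseteq> ?S" "\<And>i. P i \<subseteq> ?S"
    by (auto simp: F_def E_def P_def full_staircase_diagrams_def staircase_diagrams_def)
  have "?S = F \<union> E \<union> (\<Union>i\<in>{3..<n}. P i)"
  proof (intro equalityI subsetI)
    fix p
    assume "p \<in> ?S"
    then obtain D r where p: "p = (D, r)" and S: "(D, r) \<in> ?S"
      by (cases p) auto
    then have D: "\<Union>D \<subseteq> {1..n}"
      using staircase_diagramD(2)[of "D_graph n" D r] by (auto simp: staircase_diagrams_def)
    show "p \<in> F \<union> E \<union> (\<Union>i\<in>{3..<n}. P i)"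
    proof (cases "{1..n} \<subseteq> \<Union>D")
      case True
      then have "\<Union>D = {1..n}"
        using D by (rule subset_antisym[rotated])
      then show ?thesis
        using S by (simp add: p F_def full_staircase_diagrams_def fully_supported_def staircase_diagrams_def)
    next
      case False
      \<comment> \<open>A least gap at 1, 2 or 3 puts the diagram into \<open>E\<close>; a later one
        puts it into \<open>P (k - 1)\<close>.\<close>
      define k where "k = (LEAST k. k \<in> {1..n} \<and> k \<notin> \<Union>D)"
      have "\<exists>k. k \<in> {1..n} \<and> k \<notin> \<Union>D"
        using False by blast
      from LeastI_ex[OF this, folded k_def] have k: "k \<in> {1..n}" "k \<notin> \<Union>D"
        by simp_all
      have below: "{1..k - 1} \<subseteq> \<Union>D"
      proof
        fix j
        assume "j \<in> {1..k - 1}"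
        then have "j < k" "j \<in> {1..n}"
          using k(1) by auto
        then show "j \<in> \<Union>D"
          using not_less_Least[of j, folded k_def] unfolding k_def by blast
      qed
      show ?thesis
      proof (cases "k \<le> 3")
        case True
        then have "k \<in> {1, 2, 3}" using k(1) by auto
        then have "p \<in> E" using k(2) S unfolding p E_def by blast
        then show ?thesis by simp
      next
        case False
        then have "Suc (k - 1) = k" "k - 1 \<in> {3..<n}"
          using k(1) by auto
        moreover from this have "p \<in> P (k - 1)"
          using S k(2) below by (simp add: p P_def)
        ultimately show ?thesis by blast
      qed
    qed
  qed (use sub in blast)
  moreover have "(F \<union> E) \<inter> (\<Union>i\<in>{3..<n}. P i) = {}"
  proof -
    have "p \<notin> P i" if "i \<in> {3..<n}" "p \<in> F \<union> E" for p i
    proof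
      assume "p \<in> P i"
      then obtain D r where p: "p = (D, r)" "{1..i} \<subseteq> \<Union>D" "Suc i \<notin> \<Union>D"
        by (auto simp: P_def)
      \<comment> \<open>Since \<open>i \<ge> 3\<close>, members of \<open>P i\<close> support the
        fork, unlike those of \<open>E\<close>; since \<open>i < n\<close>, the gap is a genuine
        vertex, unlike in \<open>F\<close>.\<close>
      have i: "{1, 2, 3} \<subseteq> {1..i}" "Suc i \<in> {1..n}"
        using that(1) by auto
      have "\<Union>D \<noteq> {1..n}"
        using i(2) p(3) by metis
      then have "p \<notin> F"
        by (simp add: p(1) F_def full_staircase_diagrams_def fully_supported_def)
      moreover have "p \<notin> E"
        using subset_trans[OF i(1) p(2)] by (simp add: p(1) E_def)
      ultimately show False
        using that(2) by blast
    qed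
    then show ?thesis by blast
  qed
  moreover have "F \<inter> E = {}"
    using n by (auto simp: F_def E_def full_staircase_diagrams_def fully_supported_def)
  moreover have "card (\<Union>i\<in>{3..<n}. P i) = (\<Sum>i\<in>{3..<n}. card (P i))"
  proof (rule card_UN_disjoint)
    have "P i \<inter> P j = {}" if "i < j" for i j
    proof -
      \<comment> \<open>The vertex \<open>Suc i\<close>, omitted in \<open>P i\<close>, is required
        to be supported in \<open>P j\<close>.\<close>
      have "Suc i \<in> {1..j}" using that by simp
      then show ?thesis unfolding P_def by blast
    qed
    then have "P i \<inter> P j = {}" if "i \<noteq> j" for i j
      using that by (metis Int_commute linorder_neqE_nat)
    then show "\<forall>i\<in>{3..<n}. \<forall>j\<in>{3..<n}. i \<noteq> j \<longrightarrow> P i \<inter> P j = {}"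
      by simp
    show "\<forall>i\<in>{3..<n}. finite (P i)"
      using finite_subset[OF sub(3) fin] by simp
  qed simp
  moreover have "finite F" "finite E" "finite (\<Union>i\<in>{3..<n}. P i)"
    using finite_subset[OF _ fin] sub by simp_all
  ultimately have "card ?S = card F + card E + (\<Sum>i\<in>{3..<n}. card (P i))"
    by (simp add: card_Un_disjoint)
  moreover have "card (P i) = D_full_count i * path_count (n - 1 - i)" if "i \<in> {3..<n}" for i
    using card_D_first_gap[of i n] that by (simp add: P_def)
  ultimately show ?thesis
    using card_D_not_full_on_fork[OF n]
    by (simp add: D_count_def D_full_count_def F_def E_def)
qed

text \<open>Coefficients are compared. From degree 3 on this is the recurrence; below, both
  \<open>D_series\<close> and \<open>D_full_series\<close> vanish by definition, and
  \<open>2 * a 0 = 2\<close> and \<open>2 * a 1 - a 0 = 3\<close> match the polynomial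
  correction.\<close>

theorem theorem10p18:
  shows "D_series =
    - 2 * fps_X - 3 * fps_X ^ 2
    + (2 * fps_X - fps_X ^ 2 + fps_X ^ 3) * path_series
    + (fps_X * path_series + 1) * D_full_series"
proof (rule fps_ext)
  fix n
  define a where "a k = int (path_count k)" for k
  define b where "b k = (if 3 \<le> k then int (D_full_count k) else 0)" for k
  have A: "fps_nth path_series k = a k" and B: "fps_nth D_full_series k = b k" for k
    by (simp_all add: path_series_def D_full_series_def a_def b_def)
  have "fps_nth (fps_X * path_series * D_full_series) n = (\<Sum>i\<in>{3..<n}. b i * a (n - 1 - i))"
  proof -
    have "fps_nth (fps_X * path_series * D_full_series) n = fps_nth (D_full_series * (fps_X * path_series)) n"
      by (simp add: mult.commute)
    also have "\<dots> = (\<Sum>i=0..n. b i * (if n - i = 0 then 0 else a (n - i - 1)))"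
      unfolding fps_mult_nth[of D_full_series] by (simp add: A B cong: if_cong)
    also have "\<dots> = (\<Sum>i\<in>{3..<n}. b i * a (n - 1 - i))"
      \<comment> \<open>Terms with \<open>i < 3\<close> vanish through \<open>b\<close>, and the
        term \<open>i = n\<close> vanishes because the factor \<open>fps_X\<close> has no constant
        coefficient.\<close>
      by (rule sum.mono_neutral_cong_right) (auto simp: b_def)
    finally show ?thesis .
  qed
  moreover have "fps_nth (fps_X * path_series) n = (if n = 0 then 0 else a (n - 1))"
      "fps_nth (fps_X ^ 2 * path_series) n = (if n < 2 then 0 else a (n - 2))"
      "fps_nth (fps_X ^ 3 * path_series) n = (if n < 3 then 0 else a (n - 3))"
    by (simp_all add: A fps_X_power_mult_nth cong: if_cong)
  moreover have "a 0 = 1" "a 1 = 2"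
    using path_count_0 path_count_1 by (simp_all add: a_def)
  moreover have "fps_nth D_series n = b n + (2 * a (n - 1) - a (n - 2) + a (n - 3))
      + (\<Sum>i\<in>{3..<n}. b i * a (n - 1 - i))" if "3 \<le> n"
    using D_count_rec[OF that] that by (simp add: D_series_def a_def b_def)
  moreover have "n = 0 \<or> n = 1 \<or> n = 2 \<or> 3 \<le> n"
    by linarith
  \<comment> \<open>Expanding the products and writing numerals as \<open>fps_const\<close>
    expresses every coefficient through the products evaluated above.\<close>
  moreover have "- 2 * fps_X - 3 * fps_X ^ 2
    + (2 * fps_X - fps_X ^ 2 + fps_X ^ 3) * path_series
    + (fps_X * path_series + 1) * D_full_series =
    fps_const (- 2) * fps_X - fps_const 3 * fps_X ^ 2 + fps_const 2 * (fps_X * path_series)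
    - fps_X ^ 2 * path_series + fps_X ^ 3 * path_series
    + fps_X * path_series * D_full_series + D_full_series"
    by (simp add: algebra_simps numeral_fps_const flip: fps_const_neg)
  ultimately show "fps_nth D_series n =
    fps_nth (- 2 * fps_X - 3 * fps_X ^ 2
    + (2 * fps_X - fps_X ^ 2 + fps_X ^ 3) * path_series
    + (fps_X * path_series + 1) * D_full_series) n"
    by (auto simp: B D_series_def b_def)
qed

end
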